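(* Let $D$ be an integral domain, $k=\operatorname{Frac}D$ its fraction field, and $V$ a valuation domain with residue field $k$. Let $R$ be the pullback of the diagram $D\to k\leftarrow V$, i.e. $R=\{v\in V:\ \text{the image of } v \text{ in } k \text{ lies in } D\}$. Then $R$ is perinormal if and only if $D$ is perinormal.
   Context: All rings are commutative with identity; "local" means having a unique maximal ideal (no Noetherian assumption). In the diagram, $D\to k$ is the inclusion and $V\to k$ is the residue map. An overring of an integral domain $R$ is a ring between $R$ and its fraction field. A ring extension $R\subseteq T$ satisfies going-down if whenever $\mathfrak p_1\subseteq\mathfrak p_2$ are primes of $R$ and $Q_2\in\operatorname{Spec}T$ satisfies $Q_2\cap R=\mathfrak p_2$, there is $Q_1\in\operatorname{Spec}T$ with $Q_1\subseteq Q_2$ and $Q_1\cap R=\mathfrak p_1$. An integral domain $R$ is perinormal if every local overring $L$ of $R$ such that $R\subseteq L$ satisfies going-down is a localization of $R$ (i.e. $L=R_{\mathfrak p}$ for some $\mathfrak p\in\operatorname{Spec}R$). *)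

theory Defs
  imports "HOL-Algebra.QuotRing" "HOL-Algebra.Subrings"
begin

section \<open>Fraction fields\<close>

text \<open>A fraction \<open>a/b\<close> is the set of all pairs \<open>(c, d)\<close> with \<open>d \<noteq> 0\<close> and \<open>a d = c b\<close>.\<close>

definition fract :: "('a, 'm) ring_scheme \<Rightarrow> 'a \<Rightarrow> 'a \<Rightarrow> ('a \<times> 'a) set" where
  "fract R a b =
    {(c, d). c \<in> carrier R \<and> d \<in> carrier R - {\<zero>\<^bsub>R\<^esub>} \<and> a \<otimes>\<^bsub>R\<^esub> d = c \<otimes>\<^bsub>R\<^esub> b}"

text \<open>The unions below range over all representatives; each is a union of copies of one set
  (see \<open>fract_mult\<close> and \<open>fract_add\<close>).\<close>

definition fraction_field :: "('a, 'm) ring_scheme \<Rightarrow> ('a \<times> 'a) set ring" where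
  "fraction_field R =
    \<lparr>carrier = {fract R a b | a b. a \<in> carrier R \<and> b \<in> carrier R - {\<zero>\<^bsub>R\<^esub>}},
     monoid.mult = (\<lambda>F G. \<Union>(a, b)\<in>F. \<Union>(c, d)\<in>G. fract R (a \<otimes>\<^bsub>R\<^esub> c) (b \<otimes>\<^bsub>R\<^esub> d)),
     one = fract R \<one>\<^bsub>R\<^esub> \<one>\<^bsub>R\<^esub>,
     zero = fract R \<zero>\<^bsub>R\<^esub> \<one>\<^bsub>R\<^esub>,
     add = (\<lambda>F G. \<Union>(a, b)\<in>F. \<Union>(c, d)\<in>G.
       fract R (a \<otimes>\<^bsub>R\<^esub> d \<oplus>\<^bsub>R\<^esub> c \<otimes>\<^bsub>R\<^esub> b) (b \<otimes>\<^bsub>R\<^esub> d))\<rparr>"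

definition fract_embed :: "('a, 'm) ring_scheme \<Rightarrow> 'a \<Rightarrow> ('a \<times> 'a) set" where
  "fract_embed R a = fract R a \<one>\<^bsub>R\<^esub>"

context domain
begin

lemma fract_eq_iff:
  assumes "a \<in> carrier R" "b \<in> carrier R - {\<zero>}" "c \<in> carrier R" "d \<in> carrier R - {\<zero>}"
  shows "fract R a b = fract R c d \<longleftrightarrow> a \<otimes> d = c \<otimes> b"
proof
  assume "fract R a b = fract R c d"
  moreover have "(c, d) \<in> fract R c d"
    using assms by (simp add: fract_def)
  ultimately show "a \<otimes> d = c \<otimes> b"
    by (auto simp: fract_def)
next
  assume eq: "a \<otimes> d = c \<otimes> b"
  have "a \<otimes> y = x \<otimes> b \<longleftrightarrow> c \<otimes> y = x \<otimes> d" if "x \<in> carrier R" "y \<in> carrier R" for x y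
  proof -
    have "a \<otimes> y = x \<otimes> b \<longleftrightarrow> d \<otimes> (a \<otimes> y) = d \<otimes> (x \<otimes> b)"
      using assms that by (simp add: m_lcancel)
    also have "d \<otimes> (a \<otimes> y) = (a \<otimes> d) \<otimes> y"
      using assms that by (simp add: m_ac)
    also have "\<dots> = b \<otimes> (c \<otimes> y)"
      unfolding eq using assms that by (simp add: m_ac)
    also have "d \<otimes> (x \<otimes> b) = b \<otimes> (x \<otimes> d)"
      using assms that by (simp add: m_ac)
    finally show ?thesis
      using assms that by (simp add: m_lcancel)
  qed
  then show "fract R a b = fract R c d"
    by (auto simp: fract_def)
qed

lemma fract_memD:
  assumes "(c, d) \<in> fract R a b"
  shows "c \<in> carrier R" "d \<in> carrier R - {\<zero>}" "a \<otimes> d = c \<otimes> b"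
  using assms by (auto simp: fract_def)

lemma fract_refl:
  "a \<in> carrier R \<Longrightarrow> b \<in> carrier R - {\<zero>} \<Longrightarrow> (a, b) \<in> fract R a b"
  by (simp add: fract_def)

lemma denom_mult:
  "b \<in> carrier R - {\<zero>} \<Longrightarrow> d \<in> carrier R - {\<zero>} \<Longrightarrow> b \<otimes> d \<in> carrier R - {\<zero>}"
  by (auto simp: integral_iff)

lemma fract_mult:
  assumes "a \<in> carrier R" "b \<in> carrier R - {\<zero>}" "c \<in> carrier R" "d \<in> carrier R - {\<zero>}"
  shows "fract R a b \<otimes>\<^bsub>fraction_field R\<^esub> fract R c d = fract R (a \<otimes> c) (b \<otimes> d)"
proof -
  have "fract R (x \<otimes> u) (y \<otimes> v) = fract R (a \<otimes> c) (b \<otimes> d)"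
    if xy: "(x, y) \<in> fract R a b" and uv: "(u, v) \<in> fract R c d" for x y u v
  proof (subst fract_eq_iff)
    note m = fract_memD(1,2)[OF xy] fract_memD(1,2)[OF uv]
    have "(x \<otimes> u) \<otimes> (b \<otimes> d) = (x \<otimes> b) \<otimes> (u \<otimes> d)"
      using m assms by (simp add: m_ac)
    also have "\<dots> = (a \<otimes> y) \<otimes> (c \<otimes> v)"
      using fract_memD(3)[OF xy] fract_memD(3)[OF uv] by simp
    also have "\<dots> = (a \<otimes> c) \<otimes> (y \<otimes> v)"
      using m assms by (simp add: m_ac)
    finally show "x \<otimes> u \<otimes> (b \<otimes> d) = a \<otimes> c \<otimes> (y \<otimes> v)" .
  qed (use fract_memD[OF xy] fract_memD[OF uv] assms denom_mult in auto)
  then have "(\<Union>(x, y)\<in>fract R a b. \<Union>(u, v)\<in>fract R c d. fract R (x \<otimes> u) (y \<otimes> v))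
      = (\<Union>p\<in>fract R a b. \<Union>q\<in>fract R c d. fract R (a \<otimes> c) (b \<otimes> d))"
    by (auto intro!: SUP_cong simp del: SUP_const UN_constant split: prod.splits)
  also have "\<dots> = fract R (a \<otimes> c) (b \<otimes> d)"
  proof -
    have "(a, b) \<in> fract R a b" "(c, d) \<in> fract R c d"
      using assms by (auto intro: fract_refl)
    then have "fract R a b \<noteq> {}" "fract R c d \<noteq> {}"
      by blast+
    then show ?thesis
      by simp
  qed
  finally show ?thesis
    by (simp add: fraction_field_def)
qed

lemma fract_add:
  assumes "a \<in> carrier R" "b \<in> carrier R - {\<zero>}" "c \<in> carrier R" "d \<in> carrier R - {\<zero>}"
  shows "fract R a b \<oplus>\<^bsub>fraction_field R\<^esub> fract R c d = fract R (a \<otimes> d \<oplus> c \<otimes> b) (b \<otimes> d)"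
proof -
  have "fract R (x \<otimes> v \<oplus> u \<otimes> y) (y \<otimes> v) = fract R (a \<otimes> d \<oplus> c \<otimes> b) (b \<otimes> d)"
    if xy: "(x, y) \<in> fract R a b" and uv: "(u, v) \<in> fract R c d" for x y u v
  proof (subst fract_eq_iff)
    note m = fract_memD(1,2)[OF xy] fract_memD(1,2)[OF uv]
    have "(x \<otimes> v \<oplus> u \<otimes> y) \<otimes> (b \<otimes> d) = (x \<otimes> b) \<otimes> (v \<otimes> d) \<oplus> (u \<otimes> d) \<otimes> (y \<otimes> b)"
      using m assms by (simp add: l_distr r_distr m_ac)
    also have "\<dots> = (a \<otimes> y) \<otimes> (v \<otimes> d) \<oplus> (c \<otimes> v) \<otimes> (y \<otimes> b)"
      using fract_memD(3)[OF xy] fract_memD(3)[OF uv] by simp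
    also have "\<dots> = (a \<otimes> d \<oplus> c \<otimes> b) \<otimes> (y \<otimes> v)"
      using m assms by (simp add: l_distr r_distr m_ac)
    finally show "(x \<otimes> v \<oplus> u \<otimes> y) \<otimes> (b \<otimes> d) = (a \<otimes> d \<oplus> c \<otimes> b) \<otimes> (y \<otimes> v)" .
  qed (use fract_memD[OF xy] fract_memD[OF uv] assms denom_mult in auto)
  then have "(\<Union>(x, y)\<in>fract R a b. \<Union>(u, v)\<in>fract R c d. fract R (x \<otimes> v \<oplus> u \<otimes> y) (y \<otimes> v))
      = (\<Union>p\<in>fract R a b. \<Union>q\<in>fract R c d. fract R (a \<otimes> d \<oplus> c \<otimes> b) (b \<otimes> d))"
    by (auto intro!: SUP_cong simp del: SUP_const UN_constant split: prod.splits)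
  also have "\<dots> = fract R (a \<otimes> d \<oplus> c \<otimes> b) (b \<otimes> d)"
  proof -
    have "(a, b) \<in> fract R a b" "(c, d) \<in> fract R c d"
      using assms by (auto intro: fract_refl)
    then have "fract R a b \<noteq> {}" "fract R c d \<noteq> {}"
      by blast+
    then show ?thesis
      by simp
  qed
  finally show ?thesis
    by (simp add: fraction_field_def)
qed

lemma fraction_field_carrier:
  "carrier (fraction_field R) = {fract R a b | a b. a \<in> carrier R \<and> b \<in> carrier R - {\<zero>}}"
  by (simp add: fraction_field_def)

lemma fract_closed:
  "a \<in> carrier R \<Longrightarrow> b \<in> carrier R - {\<zero>} \<Longrightarrow> fract R a b \<in> carrier (fraction_field R)"
  unfolding fraction_field_carrier by blast

lemma fraction_field_one: "\<one>\<^bsub>fraction_field R\<^esub> = fract R \<one> \<one>"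
  and fraction_field_zero: "\<zero>\<^bsub>fraction_field R\<^esub> = fract R \<zero> \<one>"
  by (simp_all add: fraction_field_def)

lemma fraction_fieldE:
  assumes "F \<in> carrier (fraction_field R)"
  obtains a b where "a \<in> carrier R" "b \<in> carrier R" "b \<noteq> \<zero>" "F = fract R a b"
  using assms unfolding fraction_field_carrier by blast

lemma field_fraction_field: "field (fraction_field R)"
proof (rule cring.cring_fieldI2)
  note simps = fract_mult fract_add fract_closed fract_eq_iff denom_mult
    fraction_field_one fraction_field_zero integral_iff
  show "cring (fraction_field R)"
  proof (rule cringI)
    show "abelian_group (fraction_field R)"
    proof (rule abelian_groupI)
      fix F G H
      assume "F \<in> carrier (fraction_field R)" "G \<in> carrier (fraction_field R)"
        "H \<in> carrier (fraction_field R)"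
      then show "F \<oplus>\<^bsub>fraction_field R\<^esub> G \<oplus>\<^bsub>fraction_field R\<^esub> H
          = F \<oplus>\<^bsub>fraction_field R\<^esub> (G \<oplus>\<^bsub>fraction_field R\<^esub> H)"
        by (elim fraction_fieldE) (simp add: simps l_distr r_distr m_ac a_ac)
    next
      fix F
      assume "F \<in> carrier (fraction_field R)"
      then obtain a b where F: "a \<in> carrier R" "b \<in> carrier R" "b \<noteq> \<zero>" "F = fract R a b"
        by (elim fraction_fieldE)
      have "\<ominus> a \<otimes> b \<oplus> a \<otimes> b = \<zero>"
        using F by (simp add: l_minus l_neg)
      then have "fract R (\<ominus> a) b \<oplus>\<^bsub>fraction_field R\<^esub> F = \<zero>\<^bsub>fraction_field R\<^esub>"
        using F by (simp add: simps)
      then show "\<exists>G\<in>carrier (fraction_field R). G \<oplus>\<^bsub>fraction_field R\<^esub> F = \<zero>\<^bsub>fraction_field R\<^esub>"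
        using F by (intro bexI[of _ "fract R (\<ominus> a) b"]) (auto simp: simps)
    qed (auto elim!: fraction_fieldE simp: simps l_distr r_distr m_ac a_ac)
    show "Group.comm_monoid (fraction_field R)"
      by (rule comm_monoidI) (auto elim!: fraction_fieldE simp: simps m_ac)
    fix F G H
    assume "F \<in> carrier (fraction_field R)" "G \<in> carrier (fraction_field R)"
      "H \<in> carrier (fraction_field R)"
    then show "(F \<oplus>\<^bsub>fraction_field R\<^esub> G) \<otimes>\<^bsub>fraction_field R\<^esub> H
        = F \<otimes>\<^bsub>fraction_field R\<^esub> H \<oplus>\<^bsub>fraction_field R\<^esub> G \<otimes>\<^bsub>fraction_field R\<^esub> H"
      by (elim fraction_fieldE) (simp add: simps l_distr r_distr m_ac)
  qed
  show "\<zero>\<^bsub>fraction_field R\<^esub> \<noteq> \<one>\<^bsub>fraction_field R\<^esub>"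
    by (simp add: simps)
  fix F
  assume "F \<in> carrier (fraction_field R)" "F \<noteq> \<zero>\<^bsub>fraction_field R\<^esub>"
  then obtain a b where F: "a \<in> carrier R" "b \<in> carrier R" "b \<noteq> \<zero>" "F = fract R a b" "a \<noteq> \<zero>"
    by (elim fraction_fieldE) (auto simp: simps)
  then show "\<exists>G\<in>carrier (fraction_field R). F \<otimes>\<^bsub>fraction_field R\<^esub> G = \<one>\<^bsub>fraction_field R\<^esub>"
    by (intro bexI[of _ "fract R b a"]) (auto simp: simps m_ac)
qed

lemma fract_embed_hom: "fract_embed R \<in> ring_hom R (fraction_field R)"
  by (rule ring_hom_memI)
    (auto simp: fract_embed_def fract_closed fract_mult fract_add fraction_field_one)

lemma inj_on_fract_embed: "inj_on (fract_embed R) (carrier R)"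
  by (rule inj_onI) (simp add: fract_embed_def fract_eq_iff)

lemma fract_eq_quotient:
  assumes "a \<in> carrier R" "b \<in> carrier R - {\<zero>}"
  shows "fract R a b \<otimes>\<^bsub>fraction_field R\<^esub> fract_embed R b = fract_embed R a"
  using assms by (simp add: fract_embed_def fract_mult fract_eq_iff m_ac)

end


section \<open>Perinormal domains\<close>

definition overring :: "('a \<times> 'a) set set \<Rightarrow> ('a, 'm) ring_scheme \<Rightarrow> bool" where
  "overring L R \<longleftrightarrow> subring L (fraction_field R) \<and> fract_embed R ` carrier R \<subseteq> L"

definition localization :: "('a, 'm) ring_scheme \<Rightarrow> 'a set \<Rightarrow> ('a \<times> 'a) set set" where
  "localization R P = {fract R a s | a s. a \<in> carrier R \<and> s \<in> carrier R - P}"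

definition local_ring :: "('a, 'm) ring_scheme \<Rightarrow> bool" where
  "local_ring R \<longleftrightarrow> cring R \<and> (\<exists>!M. maximalideal M R)"

text \<open>Going-down for an extension given as a literal inclusion \<open>carrier R \<subseteq> carrier T\<close>.\<close>

definition going_down :: "('a, 'm) ring_scheme \<Rightarrow> ('a, 'n) ring_scheme \<Rightarrow> bool" where
  "going_down R T \<longleftrightarrow>
    (\<forall>P1 P2 Q2. primeideal P1 R \<and> primeideal P2 R \<and> P1 \<subseteq> P2 \<and>
        primeideal Q2 T \<and> Q2 \<inter> carrier R = P2 \<longrightarrow>
      (\<exists>Q1. primeideal Q1 T \<and> Q1 \<subseteq> Q2 \<and> Q1 \<inter> carrier R = P1))"

text \<open>Overrings are subsets of the fraction field, so in the going-down condition \<open>R\<close> is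
  replaced by its image in the fraction field.\<close>

definition perinormal :: "('a, 'm) ring_scheme \<Rightarrow> bool" where
  "perinormal R \<longleftrightarrow> domain R \<and>
    (\<forall>L. overring L R \<and>
        local_ring (fraction_field R\<lparr>carrier := L\<rparr>) \<and>
        going_down (fraction_field R\<lparr>carrier := fract_embed R ` carrier R\<rparr>)
          (fraction_field R\<lparr>carrier := L\<rparr>) \<longrightarrow>
      (\<exists>P. primeideal P R \<and> L = localization R P))"


section \<open>The pullback\<close>

definition valuation_domain :: "('a, 'm) ring_scheme \<Rightarrow> bool" where
  "valuation_domain V \<longleftrightarrow> domain V \<and>
    (\<forall>x \<in> carrier (fraction_field V) - {\<zero>\<^bsub>fraction_field V\<^esub>}.
      x \<in> fract_embed V ` carrier V \<or> inv\<^bsub>fraction_field V\<^esub> x \<in> fract_embed V ` carrier V)"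

text \<open>\<open>V \<rightarrow> V/M \<rightarrow> k\<close>, where \<open>\<theta>\<close> identifies the residue field \<open>V/M\<close> with \<open>k\<close>.\<close>

definition residue_map ::
    "('b, 'n) ring_scheme \<Rightarrow> 'b set \<Rightarrow> ('b set \<Rightarrow> 'c) \<Rightarrow> 'b \<Rightarrow> 'c" where
  "residue_map V M \<theta> v = \<theta> (M +>\<^bsub>V\<^esub> v)"

definition residue_pullback ::
    "('a, 'm) ring_scheme \<Rightarrow> ('b, 'n) ring_scheme \<Rightarrow> ('b \<Rightarrow> ('a \<times> 'a) set) \<Rightarrow>
      ('b, 'n) ring_scheme" where
  "residue_pullback D V \<phi> =
    V\<lparr>carrier := {v \<in> carrier V. \<phi> v \<in> fract_embed D ` carrier D}\<rparr>"

end

theory Submission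
  imports Defs
begin

text \<open>
  Let \<open>M\<close> be the kernel of \<open>V \<rightarrow> k\<close>, and let \<open>L\<close> be an overring of \<open>R\<close>. If \<open>x \<in> L\<close> is not in \<open>V\<close>,
  then \<open>x\<^sup>-\<^sup>1 \<in> M \<subseteq> R\<close>, so every \<open>v = (v x\<^sup>-\<^sup>1) x\<close> in \<open>V\<close> lies in \<open>L\<close>. Hence \<open>L\<close> is comparable to \<open>V\<close>.
  The overrings containing \<open>V\<close> are always localizations of \<open>R\<close>. Those contained in \<open>V\<close> contain \<open>M\<close>
  and correspond, by taking preimages, to the overrings \<open>E\<close> of \<open>D\<close> in \<open>k\<close>. Since an element of \<open>L\<close>
  is a unit if its image in \<open>E\<close> is one, \<open>L\<close> is local if and only if \<open>E\<close> is, and \<open>L\<close> is a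
  localization of \<open>R\<close> if and only if \<open>E\<close> is one of \<open>D\<close>. For going-down, the primes of \<open>R\<close> containing
  \<open>M\<close> are handled by the correspondence with \<open>D\<close>; every other prime \<open>P\<close> of \<open>R\<close> is already a prime
  ideal of \<open>L\<close>, so it lies over itself.
\<close>

section \<open>Ideals under surjective ring homomorphisms\<close>

lemma image_Collect_mem_eq: "J \<subseteq> h ` A \<Longrightarrow> h ` {r \<in> A. h r \<in> J} = J"
  by blast

lemma (in ring_hom_ring) ideal_image:
  assumes "h ` carrier R = carrier S" "ideal I R"
  shows "ideal (h ` I) S"
proof (rule idealI)
  interpret I: ideal I R by fact
  note I.Icarr [simp]
  show "ring S" by (rule S.ring_axioms)
  show "subgroup (h ` I) (add_monoid S)"
  proof (rule S.add.subgroupI)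
    fix a assume "a \<in> h ` I"
    then obtain x where x: "x \<in> I" "a = h x" by blast
    then have "\<ominus>\<^bsub>S\<^esub> a = h (\<ominus> x)" by simp
    then show "\<ominus>\<^bsub>S\<^esub> a \<in> h ` I" using x by blast
  next
    show "h ` I \<noteq> {}" using I.zero_closed by blast
  next
    fix a b assume "a \<in> h ` I" "b \<in> h ` I"
    then obtain x y where xy: "x \<in> I" "a = h x" "y \<in> I" "b = h y" by blast
    then have "a \<oplus>\<^bsub>S\<^esub> b = h (x \<oplus> y)" by simp
    then show "a \<oplus>\<^bsub>S\<^esub> b \<in> h ` I" using xy by blast
  qed auto
  fix a s assume "a \<in> h ` I" "s \<in> carrier S"
  then obtain x y where xy: "x \<in> I" "a = h x" "y \<in> carrier R" "s = h y"
    using assms(1) by blast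
  then have "s \<otimes>\<^bsub>S\<^esub> a = h (y \<otimes> x)" "a \<otimes>\<^bsub>S\<^esub> s = h (x \<otimes> y)" by simp_all
  then show "s \<otimes>\<^bsub>S\<^esub> a \<in> h ` I" "a \<otimes>\<^bsub>S\<^esub> s \<in> h ` I"
    using I.I_l_closed[of x y] I.I_r_closed[of x y] xy by (metis image_eqI)+
qed

text \<open>Some \<open>y\<close> in \<open>I\<close> has the same image as \<open>x\<close>, and
  their difference is in the kernel, hence in \<open>I\<close>.\<close>

lemma (in ring_hom_ring) mem_ideal_if_image_mem:
  assumes "ideal I R" "a_kernel R S h \<subseteq> I" "x \<in> carrier R" "h x \<in> h ` I"
  shows "x \<in> I"
proof -
  interpret I: ideal I R by fact
  obtain y where y: "y \<in> I" "h x = h y" using assms(4) by blast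
  then have yc: "y \<in> carrier R" by simp
  have "h (x \<ominus> y) = \<zero>\<^bsub>S\<^esub>"
    using y yc assms(3) by (simp add: a_minus_def S.r_neg)
  then have "x \<ominus> y \<in> I"
    using yc assms(2,3) unfolding a_kernel_def' by auto
  then have "(x \<ominus> y) \<oplus> y \<in> I" using y by simp
  then show ?thesis using yc assms(3) by (simp add: a_minus_def R.a_assoc R.l_neg)
qed

lemma (in ring_hom_ring) vimage_image_ideal:
  assumes "ideal I R" "a_kernel R S h \<subseteq> I"
  shows "{r \<in> carrier R. h r \<in> h ` I} = I"
  using mem_ideal_if_image_mem[OF assms] ideal.Icarr[OF assms(1)] by blast

text \<open>Because \<open>I\<close> contains the kernel, membership in \<open>I\<close> can be
  tested after applying \<open>h\<close>. Properness and primality therefore pass to the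
  image.\<close>

lemma (in ring_hom_ring) primeideal_image:
  assumes "h ` carrier R = carrier S" "cring S" "primeideal I R" "a_kernel R S h \<subseteq> I"
  shows "primeideal (h ` I) S"
proof (rule primeidealI)
  interpret I: primeideal I R by fact
  note mem = mem_ideal_if_image_mem[OF I.ideal_axioms assms(4)]
  show "ideal (h ` I) S" using assms(1) I.ideal_axioms by (rule ideal_image)
  show "cring S" by fact
  show "carrier S \<noteq> h ` I"
  proof
    assume "carrier S = h ` I"
    then have "x \<in> I" if "x \<in> carrier R" for x
      using mem[OF that] hom_closed[OF that] by simp
    then show False using I.I_notcarr I.Icarr by blast
  qed
  fix a b assume "a \<in> carrier S" "b \<in> carrier S" and ab: "a \<otimes>\<^bsub>S\<^esub> b \<in> h ` I"
  then obtain x y where xy: "x \<in> carrier R" "a = h x" "y \<in> carrier R" "b = h y"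
    using assms(1) by blast
  then have "x \<otimes> y \<in> I" using ab by (intro mem) auto
  then show "a \<in> h ` I \<or> b \<in> h ` I" using I.I_prime xy by blast
qed

section \<open>Maximal ideals and local rings along a surjection\<close>

lemma (in cring) maximalideal_comaximal:
  assumes "maximalideal I R" "x \<in> carrier R" "x \<notin> I"
  obtains i r where "i \<in> I" "r \<in> carrier R" "i \<oplus> r \<otimes> x = \<one>"
proof -
  interpret I: maximalideal I R by fact
  have J: "ideal (I <+>\<^bsub>R\<^esub> PIdl x) R"
    using I.ideal_axioms assms(2) by (intro add_ideals cgenideal_ideal)
  interpret J: ideal "I <+>\<^bsub>R\<^esub> PIdl x" R by (rule J)
  have sub: "I \<subseteq> I <+>\<^bsub>R\<^esub> PIdl x"
  proof
    fix i assume "i \<in> I"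
    moreover have "\<zero> \<in> PIdl x" using assms(2)
      by (meson additive_subgroup.zero_closed cgenideal_ideal ideal.axioms(1))
    moreover have "i = i \<oplus> \<zero>" using \<open>i \<in> I\<close> I.Icarr by simp
    ultimately show "i \<in> I <+>\<^bsub>R\<^esub> PIdl x"
      unfolding set_add_def' by blast
  qed
  have "x = \<zero> \<oplus> x" using assms(2) by simp
  moreover have "\<zero> \<in> I" by simp
  ultimately have "x \<in> I <+>\<^bsub>R\<^esub> PIdl x"
    using cgenideal_self[OF assms(2)] unfolding set_add_def' by blast
  then have "I <+>\<^bsub>R\<^esub> PIdl x \<noteq> I" using assms(3) by blast
  then have "I <+>\<^bsub>R\<^esub> PIdl x = carrier R"
    using I.I_maximal[OF J sub] J.Icarr by blast
  then have "\<one> \<in> I <+>\<^bsub>R\<^esub> PIdl x" by simp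
  then obtain i r where "i \<in> I" "r \<in> carrier R" "\<one> = i \<oplus> r \<otimes> x"
    unfolding set_add_def' cgenideal_def by blast
  then show thesis using that by metis
qed

text \<open>For a kernel element \<open>x\<close> outside \<open>I\<close>, comaximality gives
  \<open>i\<close> in \<open>I\<close> with image one. Units are reflected by \<open>h\<close>, so
  \<open>i\<close> is a unit and \<open>I\<close> is improper.\<close>

lemma (in ring_hom_ring) kernel_subset_maximalideal:
  assumes "cring R" "\<And>x. x \<in> carrier R \<Longrightarrow> h x \<in> Units S \<Longrightarrow> x \<in> Units R"
    and "maximalideal I R"
  shows "a_kernel R S h \<subseteq> I"
proof
  interpret I: maximalideal I R by fact
  interpret cring R by fact
  fix x assume "x \<in> a_kernel R S h"
  then have x: "x \<in> carrier R" "h x = \<zero>\<^bsub>S\<^esub>" unfolding a_kernel_def' by auto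
  show "x \<in> I"
  proof (rule ccontr)
    assume "x \<notin> I"
    then obtain i r where ir: "i \<in> I" "r \<in> carrier R" "i \<oplus> r \<otimes> x = \<one>"
      using maximalideal_comaximal[OF assms(3) x(1)] by blast
    have "h (i \<oplus> r \<otimes> x) = h i" using ir(1,2) x I.Icarr by simp
    then have "h i = \<one>\<^bsub>S\<^esub>" using ir(3) by simp
    then have "i \<in> Units R" using assms(2) ir I.Icarr by simp
    then have "\<one> \<in> I" using ir I.I_l_closed[OF ir(1), of "inv i"] by simp
    then show False using I.one_imp_carrier I.I_notcarr by simp
  qed
qed

text \<open>An ideal \<open>N\<close> above the preimage contains the kernel, so it is determined by
  its image, and the maximality of \<open>J\<close> leaves only two choices for that image.\<close>

lemma (in ring_hom_ring) maximalideal_vimage: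
  assumes surj: "h ` carrier R = carrier S" and "maximalideal J S"
  shows "maximalideal {r \<in> carrier R. h r \<in> J} R"
proof (rule maximalidealI)
  interpret J: maximalideal J S by fact
  let ?I = "{r \<in> carrier R. h r \<in> J}"
  show "ideal ?I R" by (rule ideal_vimage[OF J.ideal_axioms])
  show "carrier R \<noteq> ?I"
  proof
    assume "carrier R = ?I"
    then have "\<one> \<in> ?I" using R.one_closed by blast
    then show False using J.one_imp_carrier J.I_notcarr by simp
  qed
  fix N assume N: "ideal N R" "?I \<subseteq> N" "N \<subseteq> carrier R"
  have ker: "a_kernel R S h \<subseteq> N"
    using N(2) unfolding a_kernel_def' by auto
  have "J \<subseteq> h ` N"
  proof
    fix y assume "y \<in> J"
    moreover from this obtain x where "x \<in> carrier R" "y = h x" using surj J.Icarr by blast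
    ultimately show "y \<in> h ` N" using N(2) by auto
  qed
  moreover have "h ` N \<subseteq> carrier S" using N(3) by auto
  ultimately have "h ` N = J \<or> h ` N = carrier S"
    using J.I_maximal[OF ideal_image[OF surj N(1)]] by simp
  then show "N = ?I \<or> N = carrier R"
    using vimage_image_ideal[OF N(1) ker] N(2) by auto
qed

lemma (in ring_hom_ring) maximalideal_image:
  assumes surj: "h ` carrier R = carrier S" and "maximalideal I R" "a_kernel R S h \<subseteq> I"
  shows "maximalideal (h ` I) S"
proof (rule maximalidealI)
  interpret I: maximalideal I R by fact
  note eq = vimage_image_ideal[OF I.ideal_axioms assms(3)]
  show "ideal (h ` I) S" by (rule ideal_image[OF surj I.ideal_axioms])
  show "carrier S \<noteq> h ` I"
  proof
    assume "carrier S = h ` I"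
    then have "{r \<in> carrier R. h r \<in> carrier S} = I" using eq by simp
    moreover have "{r \<in> carrier R. h r \<in> carrier S} = carrier R" by auto
    ultimately show False using I.I_notcarr by simp
  qed
  fix J assume J: "ideal J S" "h ` I \<subseteq> J" "J \<subseteq> carrier S"
  have J': "h ` {r \<in> carrier R. h r \<in> J} = J" using surj J(3) by (simp add: image_Collect_mem_eq)
  have "{r \<in> carrier R. h r \<in> J} = I \<or> {r \<in> carrier R. h r \<in> J} = carrier R"
    using I.I_maximal[OF ideal_vimage[OF J(1)]] J(2) I.Icarr by blast
  then show "J = h ` I \<or> J = carrier S"
    using J' surj by auto
qed

text \<open>Reflection of units forces every maximal ideal of \<open>R\<close> to contain the
  kernel. Image and preimage are then inverse bijections between the maximal ideals of
  \<open>R\<close> and of \<open>S\<close>, so uniqueness transfers.\<close>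

lemma (in ring_hom_ring) local_ring_iff:
  assumes surj: "h ` carrier R = carrier S" and "cring R" "cring S"
    and units: "\<And>x. x \<in> carrier R \<Longrightarrow> h x \<in> Units S \<Longrightarrow> x \<in> Units R"
  shows "local_ring R \<longleftrightarrow> local_ring S"
proof -
  have ker: "a_kernel R S h \<subseteq> I" if "maximalideal I R" for I
    by (rule kernel_subset_maximalideal[OF assms(2) _ that]) (rule units)
  have vi: "{r \<in> carrier R. h r \<in> h ` I} = I" if "maximalideal I R" for I
    using vimage_image_ideal[OF _ ker[OF that]] that by (simp add: maximalideal_def)
  have iv: "h ` {r \<in> carrier R. h r \<in> J} = J" if "maximalideal J S" for J
    using surj ideal.Icarr[OF maximalideal.axioms(1)[OF that]] by (simp add: image_Collect_mem_eq subsetI)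
  have "(\<exists>!I. maximalideal I R) \<longleftrightarrow> (\<exists>!J. maximalideal J S)"
  proof
    assume "\<exists>!I. maximalideal I R"
    then obtain I where I: "maximalideal I R" "\<And>I'. maximalideal I' R \<Longrightarrow> I' = I" by (elim ex1E) blast
    show "\<exists>!J. maximalideal J S"
    proof (rule ex1I)
      show "maximalideal (h ` I) S" by (rule maximalideal_image[OF surj I(1) ker[OF I(1)]])
      fix J assume "maximalideal J S"
      then show "J = h ` I" using iv[of J] I(2)[OF maximalideal_vimage[OF surj, of J]] by simp
    qed
  next
    assume "\<exists>!J. maximalideal J S"
    then obtain J where J: "maximalideal J S" "\<And>J'. maximalideal J' S \<Longrightarrow> J' = J" by (elim ex1E) blast
    show "\<exists>!I. maximalideal I R"
    proof (rule ex1I)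
      show "maximalideal {r \<in> carrier R. h r \<in> J} R" by (rule maximalideal_vimage[OF surj J(1)])
      fix I assume "maximalideal I R"
      then show "I = {r \<in> carrier R. h r \<in> J}"
        using vi[of I] J(2)[OF maximalideal_image[OF surj _ ker, of I]] by simp
    qed
  qed
  then show ?thesis using assms by (simp add: local_ring_def)
qed

section \<open>Prime ideals and units of subrings\<close>

text \<open>Closure under negation comes from multiplying by
  \<open>\<ominus> \<one>\<close>.\<close>

lemma (in cring) primeidealI_elementwise:
  assumes "P \<subseteq> carrier R" "\<zero> \<in> P" "\<one> \<notin> P"
    and add: "\<And>x y. x \<in> P \<Longrightarrow> y \<in> P \<Longrightarrow> x \<oplus> y \<in> P"
    and mult: "\<And>a x. a \<in> carrier R \<Longrightarrow> x \<in> P \<Longrightarrow> a \<otimes> x \<in> P"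
    and prime: "\<And>a b. a \<in> carrier R \<Longrightarrow> b \<in> carrier R \<Longrightarrow> a \<otimes> b \<in> P \<Longrightarrow> a \<in> P \<or> b \<in> P"
  shows "primeideal P R"
proof (rule primeidealI)
  show "ideal P R"
  proof (rule idealI)
    show "subgroup P (add_monoid R)"
    proof (rule add.subgroupI)
      fix a assume "a \<in> P"
      then have "\<ominus> a = (\<ominus> \<one>) \<otimes> a" using assms(1) by (auto simp: l_minus)
      then show "\<ominus> a \<in> P" using mult \<open>a \<in> P\<close> by simp
    qed (use assms(1,2) add in auto)
    fix a x assume "a \<in> P" "x \<in> carrier R"
    then show "x \<otimes> a \<in> P" "a \<otimes> x \<in> P"
      using mult[of x a] assms(1) m_comm[of a x] by auto
  qed (rule ring_axioms)
  show "carrier R \<noteq> P" using assms(3) one_closed by blast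
qed (fact cring_axioms, fact prime)

text \<open>Expresses primality in a subring through the operations of the ambient ring. Together
  with \<open>primeideal_subringI\<close> this allows one set to be compared as an ideal of several
  subrings.\<close>

lemma primeideal_subringE:
  assumes "primeideal P (R\<lparr>carrier := A\<rparr>)"
  shows "P \<subseteq> A" "\<zero>\<^bsub>R\<^esub> \<in> P" "\<one>\<^bsub>R\<^esub> \<notin> P"
    and "\<And>x y. x \<in> P \<Longrightarrow> y \<in> P \<Longrightarrow> x \<oplus>\<^bsub>R\<^esub> y \<in> P"
    and "\<And>a x. a \<in> A \<Longrightarrow> x \<in> P \<Longrightarrow> a \<otimes>\<^bsub>R\<^esub> x \<in> P"
    and "\<And>a b. a \<in> A \<Longrightarrow> b \<in> A \<Longrightarrow> a \<otimes>\<^bsub>R\<^esub> b \<in> P \<Longrightarrow> a \<in> P \<or> b \<in> P"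
proof -
  interpret P: primeideal P "R\<lparr>carrier := A\<rparr>" by fact
  show "P \<subseteq> A" using P.a_subset by simp
  show "\<zero>\<^bsub>R\<^esub> \<in> P" using additive_subgroup.zero_closed[OF P.is_additive_subgroup] by simp
  show "\<one>\<^bsub>R\<^esub> \<notin> P" using P.one_imp_carrier P.I_notcarr by auto
  show "x \<oplus>\<^bsub>R\<^esub> y \<in> P" if "x \<in> P" "y \<in> P" for x y
    using additive_subgroup.a_closed[OF P.is_additive_subgroup that] by simp
  show "a \<otimes>\<^bsub>R\<^esub> x \<in> P" if "a \<in> A" "x \<in> P" for a x using P.I_l_closed[of x a] that by simp
  show "a \<in> P \<or> b \<in> P" if "a \<in> A" "b \<in> A" "a \<otimes>\<^bsub>R\<^esub> b \<in> P" for a b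
    using P.I_prime[of a b] that by simp
qed

lemma going_downD:
  assumes "going_down R T" "primeideal P1 R" "primeideal P2 R" "P1 \<subseteq> P2"
    and "primeideal Q2 T" "Q2 \<inter> carrier R = P2"
  shows "\<exists>Q1. primeideal Q1 T \<and> Q1 \<subseteq> Q2 \<and> Q1 \<inter> carrier R = P1"
  using assms unfolding going_down_def by blast

lemma (in domain) primeideal_subringI:
  assumes "subring A R" "P \<subseteq> A" "\<zero> \<in> P" "\<one> \<notin> P"
    and "\<And>x y. x \<in> P \<Longrightarrow> y \<in> P \<Longrightarrow> x \<oplus> y \<in> P"
    and "\<And>a x. a \<in> A \<Longrightarrow> x \<in> P \<Longrightarrow> a \<otimes> x \<in> P"
    and "\<And>a b. a \<in> A \<Longrightarrow> b \<in> A \<Longrightarrow> a \<otimes> b \<in> P \<Longrightarrow> a \<in> P \<or> b \<in> P"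
  shows "primeideal P (R\<lparr>carrier := A\<rparr>)"
proof -
  interpret A: "domain" "R\<lparr>carrier := A\<rparr>" by (rule subring_is_domain) fact
  show ?thesis using assms by (intro A.primeidealI_elementwise) auto
qed

section \<open>Inverses in a field and units of its subrings\<close>

context field
begin

lemma inv_in_carrier: "x \<in> carrier R \<Longrightarrow> x \<noteq> \<zero> \<Longrightarrow> inv x \<in> carrier R"
  and r_inv_nonzero: "x \<in> carrier R \<Longrightarrow> x \<noteq> \<zero> \<Longrightarrow> x \<otimes> inv x = \<one>"
  and l_inv_nonzero: "x \<in> carrier R \<Longrightarrow> x \<noteq> \<zero> \<Longrightarrow> inv x \<otimes> x = \<one>"
  and inv_inv_nonzero: "x \<in> carrier R \<Longrightarrow> x \<noteq> \<zero> \<Longrightarrow> inv (inv x) = x"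
  by (simp_all add: field_Units)

lemma inv_nonzero: "x \<in> carrier R \<Longrightarrow> x \<noteq> \<zero> \<Longrightarrow> inv x \<noteq> \<zero>"
  using r_inv_nonzero[of x] by auto

lemma mult_mult_inv_cancel:
  "x \<in> carrier R \<Longrightarrow> y \<in> carrier R \<Longrightarrow> y \<noteq> \<zero> \<Longrightarrow> x \<otimes> y \<otimes> inv y = x"
  "x \<in> carrier R \<Longrightarrow> y \<in> carrier R \<Longrightarrow> y \<noteq> \<zero> \<Longrightarrow> x \<otimes> inv y \<otimes> y = x"
  by (simp_all add: m_assoc inv_in_carrier r_inv_nonzero l_inv_nonzero)

lemma inv_mult_nonzero:
  "x \<in> carrier R \<Longrightarrow> x \<noteq> \<zero> \<Longrightarrow> y \<in> carrier R \<Longrightarrow> y \<noteq> \<zero> \<Longrightarrow> inv (x \<otimes> y) = inv x \<otimes> inv y"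
  by (rule comm_inv_char)
    (simp_all add: inv_in_carrier, metis inv_in_carrier m_closed m_comm m_lcomm r_inv_nonzero r_one)

text \<open>Used to see that a subring containing \<open>a\<close> and the inverse of
  \<open>a \<otimes> x\<close> contains the inverse of \<open>x\<close>.\<close>

lemma inv_eq_multI:
  assumes "a \<in> carrier R" "x \<in> carrier R" "x \<noteq> \<zero>" "a \<noteq> \<zero>"
  shows "inv x = a \<otimes> inv (a \<otimes> x)"
  using assms by (simp add: inv_mult_nonzero inv_in_carrier r_inv_nonzero flip: m_assoc)

text \<open>An inverse inside the subring must be the field inverse, by uniqueness of
  inverses.\<close>

lemma Units_subring_iff:
  assumes "subring A R"
  shows "x \<in> Units (R\<lparr>carrier := A\<rparr>) \<longleftrightarrow> x \<in> A \<and> x \<noteq> \<zero> \<and> inv x \<in> A"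
proof
  note A = subringE(1)[OF assms]
  assume "x \<in> Units (R\<lparr>carrier := A\<rparr>)"
  then obtain y where y: "x \<in> A" "y \<in> A" "x \<otimes> y = \<one>"
    unfolding Units_def by auto
  then have "x \<noteq> \<zero>" using A by auto
  moreover have "inv x = y" using y A by (intro comm_inv_char) auto
  ultimately show "x \<in> A \<and> x \<noteq> \<zero> \<and> inv x \<in> A" using y by simp
next
  note A = subringE(1)[OF assms]
  assume "x \<in> A \<and> x \<noteq> \<zero> \<and> inv x \<in> A"
  then show "x \<in> Units (R\<lparr>carrier := A\<rparr>)"
    using A unfolding Units_def
    by (auto simp: subset_eq r_inv_nonzero l_inv_nonzero intro!: bexI[of _ "inv x"])
qed

end

section \<open>Perinormality inside a fixed field\<close>

text \<open>Denominators are inverted in the ambient field \<open>K\<close>, so the localization is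
  a set of elements of \<open>K\<close> rather than of formal fractions over
  \<open>A\<close>.\<close>

definition subring_localization :: "('a, 'm) ring_scheme \<Rightarrow> 'a set \<Rightarrow> 'a set \<Rightarrow> 'a set" where
  "subring_localization K A P = {a \<otimes>\<^bsub>K\<^esub> inv\<^bsub>K\<^esub> s | a s. a \<in> A \<and> s \<in> A - P}"

text \<open>This is perinormality of \<open>A\<close> when \<open>K\<close> is its fraction field.
  With the field as a parameter, overrings of \<open>A\<close> are literal supersets.\<close>

definition perinormal_subring :: "('a, 'm) ring_scheme \<Rightarrow> 'a set \<Rightarrow> bool" where
  "perinormal_subring K A \<longleftrightarrow>
    (\<forall>L. subring L K \<and> A \<subseteq> L \<and> local_ring (K\<lparr>carrier := L\<rparr>) \<and>
        going_down (K\<lparr>carrier := A\<rparr>) (K\<lparr>carrier := L\<rparr>) \<longrightarrow>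
      (\<exists>P. primeideal P (K\<lparr>carrier := A\<rparr>) \<and> L = subring_localization K A P))"

lemma (in domain) fract_eq_mult_inv:
  assumes "a \<in> carrier R" "b \<in> carrier R - {\<zero>}"
  shows "fract R a b = fract_embed R a \<otimes>\<^bsub>fraction_field R\<^esub> inv\<^bsub>fraction_field R\<^esub> fract_embed R b"
proof -
  interpret K: field "fraction_field R" by (rule field_fraction_field)
  have "fract_embed R b \<noteq> \<zero>\<^bsub>fraction_field R\<^esub>"
    using assms by (simp add: fract_embed_def fraction_field_zero fract_eq_iff)
  then have "fract_embed R b \<in> Units (fraction_field R)"
    using assms by (simp add: K.field_Units fract_embed_def fract_closed)
  then show ?thesis
    using fract_eq_quotient[OF assms] fract_closed[OF assms]
    by (metis K.Units_closed K.Units_inv_closed K.Units_r_inv K.m_assoc K.r_one)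
qed

text \<open>Overrings, locality and going-down are formulated in the fraction field on both sides.
  Only primes and localizations have to be moved along \<open>fract_embed R\<close>, an isomorphism
  onto its image.\<close>

lemma (in domain) perinormal_iff_perinormal_subring:
  "perinormal R \<longleftrightarrow> perinormal_subring (fraction_field R) (fract_embed R ` carrier R)"
proof -
  let ?K = "fraction_field R" and ?A = "fract_embed R ` carrier R"
  let ?KA = "?K\<lparr>carrier := ?A\<rparr>"
  interpret K: field ?K by (rule field_fraction_field)
  interpret h: ring_hom_ring R ?K "fract_embed R"
    by (rule ring_hom_ringI2[OF ring_axioms K.ring_axioms fract_embed_hom])
  have A: "subring ?A ?K" using h.img_is_subring[OF carrier_is_subring] .
  interpret KA: "domain" ?KA using K.subring_is_domain[OF A] .
  interpret hA: ring_hom_ring R ?KA "fract_embed R"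
    by (rule ring_hom_ringI2[OF ring_axioms KA.ring_axioms])
      (use fract_embed_hom in \<open>auto simp: ring_hom_def\<close>)
  \<comment> \<open>With trivial kernel, the correspondence of primes applies to every prime of
    \<open>R\<close>.\<close>
  have ker: "a_kernel R ?KA (fract_embed R) = {\<zero>}"
    using inj_onD[OF inj_on_fract_embed, of _ \<zero>] unfolding a_kernel_def' by auto
  have surj: "fract_embed R ` carrier R = carrier ?KA" by simp
  have loc: "localization R P = subring_localization ?K ?A (fract_embed R ` P)"
    if "primeideal P R" for P
  proof -
    interpret P: primeideal P R by fact
    have mem: "fract_embed R s \<in> fract_embed R ` P \<longleftrightarrow> s \<in> P" if "s \<in> carrier R" for s
      using inj_on_image_mem_iff[OF inj_on_fract_embed that P.a_subset] .
    have nz: "s \<noteq> \<zero>" if "s \<in> carrier R - P" for s using that P.zero_closed by blast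
    show ?thesis
    proof (rule equalityI; rule subsetI)
      fix x assume "x \<in> localization R P"
      then obtain a s where as: "a \<in> carrier R" "s \<in> carrier R - P" "x = fract R a s"
        unfolding localization_def by blast
      then show "x \<in> subring_localization ?K ?A (fract_embed R ` P)"
        using fract_eq_mult_inv[of a s] mem[of s] nz[of s] unfolding subring_localization_def
        by blast
    next
      fix x assume "x \<in> subring_localization ?K ?A (fract_embed R ` P)"
      then obtain a s where as: "a \<in> carrier R" "s \<in> carrier R" "fract_embed R s \<notin> fract_embed R ` P"
        "x = fract_embed R a \<otimes>\<^bsub>?K\<^esub> inv\<^bsub>?K\<^esub> fract_embed R s"
        unfolding subring_localization_def by blast
      then show "x \<in> localization R P"
        using fract_eq_mult_inv[of a s] nz[of s] unfolding localization_def by blast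
    qed
  qed
  have pi: "primeideal (fract_embed R ` P) ?KA" if "primeideal P R" for P
  proof -
    interpret P: primeideal P R by fact
    show ?thesis
      using hA.primeideal_image[OF surj KA.cring_axioms that] ker by simp
  qed
  have "(\<exists>P. primeideal P R \<and> L = localization R P) \<longleftrightarrow>
      (\<exists>P. primeideal P ?KA \<and> L = subring_localization ?K ?A P)" for L
  proof
    assume "\<exists>P. primeideal P ?KA \<and> L = subring_localization ?K ?A P"
    then obtain Q where Q: "primeideal Q ?KA" "L = subring_localization ?K ?A Q" by blast
    let ?P = "{r \<in> carrier R. fract_embed R r \<in> Q}"
    have "primeideal ?P R" using hA.primeideal_vimage[OF cring_axioms Q(1)] .
    moreover have "fract_embed R ` ?P = Q"
      using ideal.Icarr[OF primeideal.axioms(1)[OF Q(1)]] by auto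
    ultimately show "\<exists>P. primeideal P R \<and> L = localization R P" using loc Q(2) by metis
  qed (use loc pi in blast)
  then show ?thesis
    unfolding perinormal_def perinormal_subring_def overring_def
    using domain_axioms by (simp add: conj_assoc)
qed

section \<open>The pullback square with \<open>V\<close> a valuation ring inside a field
  \<open>K\<close>\<close>

locale residue_square = K: field K + k: field k
    for K :: "('a, 'm) ring_scheme" (structure) and k :: "('b, 'n) ring_scheme" (structure) +
  fixes V :: "'a set" and \<phi> :: "'a \<Rightarrow> 'b" and D :: "'b set"
  assumes subring_V: "subring V K"
    and valuation: "\<And>x. x \<in> carrier K \<Longrightarrow> x \<noteq> \<zero> \<Longrightarrow> x \<in> V \<or> inv x \<in> V"
    and hom: "\<phi> \<in> ring_hom (K\<lparr>carrier := V\<rparr>) k"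
    and surj: "\<phi> ` V = carrier k"
    and subring_D: "subring D k"
    and quotients: "\<And>x. x \<in> carrier k \<Longrightarrow> \<exists>a\<in>D. \<exists>s\<in>D. s \<noteq> \<zero>\<^bsub>k\<^esub> \<and> x = a \<otimes>\<^bsub>k\<^esub> inv\<^bsub>k\<^esub> s"
begin

text \<open>The restriction to \<open>V\<close> matters, since \<open>\<phi>\<close> is uncontrolled
  elsewhere. The pullback is \<open>lift D\<close>, and the kernel of \<open>\<phi>\<close> is the
  lift of the zero set.\<close>

definition lift :: "'b set \<Rightarrow> 'a set" where
  "lift E = {v \<in> V. \<phi> v \<in> E}"

lemma V_carrier: "v \<in> V \<Longrightarrow> v \<in> carrier K"
  using subringE(1)[OF subring_V] by blast

lemmas V_closed = subringE(2,3,5,6,7)[OF subring_V]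

lemma V_minus_closed: "x \<in> V \<Longrightarrow> y \<in> V \<Longrightarrow> x \<ominus> y \<in> V"
  by (simp add: a_minus_def V_closed)

sublocale V: ring_hom_ring "K\<lparr>carrier := V\<rparr>" k \<phi>
  by (rule ring_hom_ringI2[OF K.subring_is_ring[OF subring_V] k.ring_axioms hom])

lemma \<phi>_simps [simp]:
  "v \<in> V \<Longrightarrow> \<phi> v \<in> carrier k"
  "\<phi> \<zero> = \<zero>\<^bsub>k\<^esub>" "\<phi> \<one> = \<one>\<^bsub>k\<^esub>"
  "x \<in> V \<Longrightarrow> y \<in> V \<Longrightarrow> \<phi> (x \<oplus> y) = \<phi> x \<oplus>\<^bsub>k\<^esub> \<phi> y"
  "x \<in> V \<Longrightarrow> y \<in> V \<Longrightarrow> \<phi> (x \<otimes> y) = \<phi> x \<otimes>\<^bsub>k\<^esub> \<phi> y"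
  using V.hom_closed[of v] V.hom_zero V.hom_one V.hom_add[of x y] V.hom_mult[of x y] by simp_all

text \<open>Negation depends on the carrier of the ring, so the homomorphism rule for
  \<open>K\<lparr>carrier := V\<rparr>\<close> does not speak of the negative taken in
  \<open>K\<close>.\<close>

lemma \<phi>_minus [simp]: "x \<in> V \<Longrightarrow> \<phi> (\<ominus> x) = \<ominus>\<^bsub>k\<^esub> \<phi> x"
  by (rule k.sum_zero_eq_neg) (simp_all add: V_closed V_carrier K.l_neg flip: \<phi>_simps(4))

text \<open>A valuation ring is local, so the kernel of \<open>\<phi>\<close> consists of all its nonunits.\<close>

lemma inv_in_V:
  assumes "v \<in> V" "\<phi> v \<noteq> \<zero>\<^bsub>k\<^esub>"
  shows "v \<noteq> \<zero>" "inv v \<in> V"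
proof -
  show v0: "v \<noteq> \<zero>" using assms by auto
  have "inv\<^bsub>k\<^esub> \<phi> v \<in> carrier k" using assms by (simp add: k.inv_in_carrier)
  then obtain u where u: "u \<in> V" "\<phi> u = inv\<^bsub>k\<^esub> \<phi> v" using surj by force
  \<comment> \<open>It suffices to invert \<open>x\<close> in \<open>V\<close>; its image is one, so
    it differs from \<open>\<one>\<close> by an element \<open>m\<close> of the kernel.\<close>
  define x where "x = u \<otimes> v"
  have x: "x \<in> V" "\<phi> x = \<one>\<^bsub>k\<^esub>"
    using u assms by (simp_all add: x_def V_closed k.l_inv_nonzero)
  then have x0: "x \<noteq> \<zero>" by auto
  define m where "m = x \<ominus> \<one>"
  have m: "m \<in> V" "\<phi> m = \<zero>\<^bsub>k\<^esub>"
    using x by (simp_all add: m_def V_minus_closed V_closed a_minus_def k.r_neg)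
  have "\<exists>w \<in> V. w \<otimes> x = \<one>"
  proof (cases "m = \<zero>")
    case True
    then have "x = \<one>" using x V_carrier by (simp add: m_def)
    then show ?thesis using V_closed(2) by (auto intro!: bexI[of _ \<one>])
  next
    case m0: False
    have mx: "m \<in> carrier K" "x \<in> carrier K" using m x V_carrier by auto
    have nz: "x \<otimes> inv m \<in> carrier K" "x \<otimes> inv m \<noteq> \<zero>"
      using mx m0 x0 by (simp_all add: K.inv_in_carrier K.integral_iff K.inv_nonzero)
    \<comment> \<open>Otherwise \<open>x\<close>, being this quotient times \<open>m\<close>, would
      map to zero. Hence the reciprocal \<open>inv x \<otimes> m\<close> is in
      \<open>V\<close>.\<close>
    have "x \<otimes> inv m \<notin> V"
    proof
      assume "x \<otimes> inv m \<in> V"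
      moreover have "x = x \<otimes> inv m \<otimes> m" using mx m0 by (simp add: K.mult_mult_inv_cancel)
      ultimately have "\<phi> x = \<phi> (x \<otimes> inv m) \<otimes>\<^bsub>k\<^esub> \<phi> m" using m(1) \<phi>_simps(5) by metis
      then show False using m x \<open>x \<otimes> inv m \<in> V\<close> by simp
    qed
    then have "inv (x \<otimes> inv m) \<in> V" using valuation[OF nz] by simp
    moreover have "inv (x \<otimes> inv m) = inv x \<otimes> m"
      using mx m0 x0 by (simp add: K.inv_mult_nonzero K.inv_in_carrier K.inv_nonzero K.inv_inv_nonzero)
    ultimately have s: "inv x \<otimes> m \<in> V" by simp
    \<comment> \<open>Since \<open>x \<ominus> m\<close> is \<open>\<one>\<close>, the inverse of
      \<open>x\<close> is \<open>\<one> \<ominus> inv x \<otimes> m\<close>, an element of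
      \<open>V\<close>.\<close>
    have "(\<one> \<ominus> inv x \<otimes> m) \<otimes> x = x \<ominus> (inv x \<otimes> x) \<otimes> m"
      using mx x0 K.inv_in_carrier[of x] by algebra
    also have "\<dots> = \<one>"
      using mx x0 by (simp add: K.l_inv_nonzero m_def) (use mx in algebra)
    finally show ?thesis using s V_minus_closed V_closed by blast
  qed
  then obtain w where w: "w \<in> V" "w \<otimes> x = \<one>" by blast
  have "inv v = w \<otimes> u"
    using w u(1) assms(1) V_carrier
    by (intro K.comm_inv_char) (auto simp: x_def K.m_ac)
  then show "inv v \<in> V" using w u V_closed by simp
qed

lemma \<phi>_inv:
  assumes "v \<in> V" "\<phi> v \<noteq> \<zero>\<^bsub>k\<^esub>"
  shows "\<phi> (inv v) = inv\<^bsub>k\<^esub> \<phi> v"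
proof -
  note v = inv_in_V[OF assms]
  have "\<phi> v \<otimes>\<^bsub>k\<^esub> \<phi> (inv v) = \<phi> (v \<otimes> inv v)" using assms v by simp
  also have "\<dots> = \<one>\<^bsub>k\<^esub>" using assms v V_carrier by (simp add: K.r_inv_nonzero)
  finally show ?thesis
    using assms v by (intro k.comm_inv_char[symmetric]) auto
qed

text \<open>The valuation property puts the inverse into \<open>V\<close>; if its image were
  nonzero, it would be a unit of \<open>V\<close> and \<open>x\<close> would lie in
  \<open>V\<close>.\<close>

lemma notin_V:
  assumes "x \<in> carrier K" "x \<notin> V"
  shows "x \<noteq> \<zero>" "inv x \<in> V" "\<phi> (inv x) = \<zero>\<^bsub>k\<^esub>"
proof -
  show x0: "x \<noteq> \<zero>" using assms V_closed by auto
  then show V: "inv x \<in> V" using valuation assms by blast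
  show "\<phi> (inv x) = \<zero>\<^bsub>k\<^esub>"
    using inv_in_V(2)[OF V] assms x0 by (auto simp: K.inv_inv_nonzero)
qed

section \<open>Correspondence between subrings of \<open>k\<close> and their preimages in
  \<open>V\<close>\<close>

lemma lift_subset: "lift E \<subseteq> V"
  by (auto simp: lift_def)

lemma lift_mono: "E \<subseteq> F \<Longrightarrow> lift E \<subseteq> lift F"
  by (auto simp: lift_def)

lemma lift_Int: "lift (E \<inter> F) = lift E \<inter> lift F"
  by (auto simp: lift_def)

lemma image_lift: "E \<subseteq> carrier k \<Longrightarrow> \<phi> ` lift E = E"
  unfolding lift_def using surj by (simp add: image_Collect_mem_eq)

text \<open>By surjectivity \<open>\<phi>\<close> recovers each set from its lift, so equations
  between lifts descend to \<open>k\<close>.\<close>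

lemma lift_eqD: "lift E = lift F \<Longrightarrow> E \<subseteq> carrier k \<Longrightarrow> F \<subseteq> carrier k \<Longrightarrow> E = F"
  using image_lift by metis

lemma lift_zero: "subring E k \<Longrightarrow> v \<in> V \<Longrightarrow> \<phi> v = \<zero>\<^bsub>k\<^esub> \<Longrightarrow> v \<in> lift E"
  by (simp add: lift_def subringE(2))

lemma subring_lift: "subring E k \<Longrightarrow> subring (lift E) K"
  by (rule K.subringI) (auto simp: lift_def V_carrier V_closed subringE)

lemma hom_lift:
  assumes "subring E k"
  shows "ring_hom_ring (K\<lparr>carrier := lift E\<rparr>) (k\<lparr>carrier := E\<rparr>) \<phi>"
proof (rule ring_hom_ringI2)
  show "ring (K\<lparr>carrier := lift E\<rparr>)" using assms subring_lift K.subring_is_ring by blast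
  show "ring (k\<lparr>carrier := E\<rparr>)" using assms k.subring_is_ring by blast
  show "\<phi> \<in> ring_hom (K\<lparr>carrier := lift E\<rparr>) (k\<lparr>carrier := E\<rparr>)"
    by (rule ring_hom_memI) (auto simp: lift_def)
qed

lemma kernel_lift:
  "subring E k \<Longrightarrow> a_kernel (K\<lparr>carrier := lift E\<rparr>) (k\<lparr>carrier := E\<rparr>) \<phi> = lift {\<zero>\<^bsub>k\<^esub>}"
  unfolding a_kernel_def' by (auto simp: lift_def subringE(2))

lemma cring_subrings:
  "subring A K \<Longrightarrow> cring (K\<lparr>carrier := A\<rparr>)"
  "subring E k \<Longrightarrow> cring (k\<lparr>carrier := E\<rparr>)"
  using K.subring_is_domain k.subring_is_domain domain.axioms(1) by blast+

lemma primeideal_lift: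
  assumes "subring E k" "primeideal q (k\<lparr>carrier := E\<rparr>)"
  shows "primeideal (lift q) (K\<lparr>carrier := lift E\<rparr>)"
proof -
  have "lift q = {r \<in> lift E. \<phi> r \<in> q}"
    using primeideal_subringE(1)[OF assms(2)] by (auto simp: lift_def)
  then show ?thesis
    using ring_hom_ring.primeideal_vimage[OF hom_lift[OF assms(1)] _ assms(2)]
      cring_subrings subring_lift assms(1) by simp
qed

text \<open>The inclusion of the kernel in \<open>Q\<close> is what lets \<open>Q\<close> be
  recovered from its image. With \<open>primeideal_lift\<close> this matches such primes with the
  primes of \<open>E\<close>.\<close>

lemma primeideal_image_lift:
  assumes "subring E k" "primeideal Q (K\<lparr>carrier := lift E\<rparr>)" "lift {\<zero>\<^bsub>k\<^esub>} \<subseteq> Q"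
  shows "primeideal (\<phi> ` Q) (k\<lparr>carrier := E\<rparr>)" "lift (\<phi> ` Q) = Q"
proof -
  interpret h: ring_hom_ring "K\<lparr>carrier := lift E\<rparr>" "k\<lparr>carrier := E\<rparr>" \<phi>
    by (rule hom_lift) fact
  have ker: "a_kernel (K\<lparr>carrier := lift E\<rparr>) (k\<lparr>carrier := E\<rparr>) \<phi> \<subseteq> Q"
    using assms kernel_lift by simp
  have im: "\<phi> ` lift E = E" using assms(1) by (intro image_lift subringE(1))
  show "primeideal (\<phi> ` Q) (k\<lparr>carrier := E\<rparr>)"
    using h.primeideal_image[OF _ cring_subrings(2)[OF assms(1)] assms(2) ker] im by simp
  have "{r \<in> lift E. \<phi> r \<in> \<phi> ` Q} = Q"
    using h.vimage_image_ideal[OF primeideal.axioms(1)[OF assms(2)] ker] by simp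
  moreover have "Q \<subseteq> lift E" by (rule primeideal_subringE(1)[OF assms(2)])
  ultimately show "lift (\<phi> ` Q) = Q" using im unfolding lift_def by blast
qed

text \<open>If \<open>\<phi> x\<close> is a unit of \<open>E\<close>, then \<open>x\<close> is
  invertible in \<open>V\<close> and its inverse maps into \<open>E\<close>. Thus
  \<open>\<phi>\<close> reflects units and \<open>local_ring_iff\<close> applies.\<close>

lemma local_ring_lift_iff:
  assumes "subring E k"
  shows "local_ring (K\<lparr>carrier := lift E\<rparr>) \<longleftrightarrow> local_ring (k\<lparr>carrier := E\<rparr>)"
proof -
  interpret h: ring_hom_ring "K\<lparr>carrier := lift E\<rparr>" "k\<lparr>carrier := E\<rparr>" \<phi>
    by (rule hom_lift) fact
  show ?thesis
  proof (rule h.local_ring_iff)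
    show "\<phi> ` carrier (K\<lparr>carrier := lift E\<rparr>) = carrier (k\<lparr>carrier := E\<rparr>)"
      using image_lift[OF subringE(1)[OF assms]] by simp
    fix x assume "x \<in> carrier (K\<lparr>carrier := lift E\<rparr>)" "\<phi> x \<in> Units (k\<lparr>carrier := E\<rparr>)"
    then show "x \<in> Units (K\<lparr>carrier := lift E\<rparr>)"
      unfolding K.Units_subring_iff[OF subring_lift[OF assms]] k.Units_subring_iff[OF assms]
      using inv_in_V[of x] \<phi>_inv[of x] by (auto simp: lift_def)
  qed (use assms cring_subrings subring_lift in auto)
qed

section \<open>Overrings of the pullback below and above \<open>V\<close>\<close>

lemma V_subset_if_not_subset:
  assumes "subring L K" "lift D \<subseteq> L" "\<not> L \<subseteq> V"
  shows "V \<subseteq> L"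
proof
  obtain x where x: "x \<in> L" "x \<notin> V" using assms(3) by blast
  then have xK: "x \<in> carrier K" using subringE(1)[OF assms(1)] by blast
  note nx = notin_V[OF xK x(2)]
  fix v assume v: "v \<in> V"
  \<comment> \<open>The inverse of \<open>x\<close> is in the kernel, which absorbs multiplication
    by \<open>V\<close>.\<close>
  have "v \<otimes> inv x \<in> lift D"
    using v nx by (intro lift_zero subring_D) (auto simp: V_closed)
  then have "v \<otimes> inv x \<otimes> x \<in> L" using assms(2) x subringE(6)[OF assms(1)] by blast
  then show "v \<in> L" using v V_carrier xK nx by (simp add: K.mult_mult_inv_cancel)
qed

text \<open>Such an \<open>L\<close> contains the kernel, so it is a union of cosets of it.\<close>

lemma lift_image_eq:
  assumes "subring L K" "lift D \<subseteq> L" "L \<subseteq> V"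
  shows "lift (\<phi> ` L) = L"
proof
  show "L \<subseteq> lift (\<phi> ` L)" using assms(3) by (auto simp: lift_def)
  show "lift (\<phi> ` L) \<subseteq> L"
  proof
    fix x assume "x \<in> lift (\<phi> ` L)"
    then obtain l where l: "x \<in> V" "l \<in> L" "\<phi> x = \<phi> l" by (auto simp: lift_def)
    moreover have lV: "l \<in> V" using l assms(3) by blast
    ultimately have "x \<ominus> l \<in> lift D"
      by (intro lift_zero subring_D) (auto simp: V_closed a_minus_def k.r_neg)
    then have "(x \<ominus> l) \<oplus> l \<in> L" using assms(2) l subringE(7)[OF assms(1)] by blast
    moreover have "(x \<ominus> l) \<oplus> l = x"
      using V_carrier[OF l(1)] V_carrier[OF lV] by (simp add: a_minus_def K.a_assoc K.l_neg)
    ultimately show "x \<in> L" by simp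
  qed
qed

lemma subring_image:
  assumes "subring L K" "L \<subseteq> V"
  shows "subring (\<phi> ` L) k"
proof (rule k.subringI)
  note L = subringE[OF assms(1)]
  have LV: "x \<in> V" if "x \<in> L" for x using that assms(2) by blast
  show "\<phi> ` L \<subseteq> carrier k" using LV by auto
  show "\<one>\<^bsub>k\<^esub> \<in> \<phi> ` L" using L(3) \<phi>_simps(3) by (metis image_eqI)
  fix h assume "h \<in> \<phi> ` L"
  then show "\<ominus>\<^bsub>k\<^esub> h \<in> \<phi> ` L" using L(5) LV by (auto simp flip: \<phi>_minus)
  fix h' assume "h' \<in> \<phi> ` L"
  with \<open>h \<in> \<phi> ` L\<close> show "h \<otimes>\<^bsub>k\<^esub> h' \<in> \<phi> ` L" "h \<oplus>\<^bsub>k\<^esub> h' \<in> \<phi> ` L"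
    using L(6,7) LV by (auto simp flip: \<phi>_simps(4,5))
qed

text \<open>The prime is the contraction to \<open>lift D\<close> of the ideal of nonunits of \<open>L\<close>.\<close>

lemma localization_if_V_subset:
  assumes "subring L K" "V \<subseteq> L"
  shows "\<exists>P. primeideal P (K\<lparr>carrier := lift D\<rparr>) \<and> L = subring_localization K (lift D) P"
proof (intro exI conjI)
  let ?R = "lift D" and ?P = "{r \<in> lift D. r = \<zero> \<or> inv r \<notin> L}"
  note L = subringE[OF assms(1)]
  have RV: "r \<in> V" if "r \<in> ?R" for r using that lift_subset by blast
  have RL: "r \<in> L" if "r \<in> ?R" for r using RV[OF that] assms(2) by blast
  have RK: "r \<in> carrier K" if "r \<in> ?R" for r using RV[OF that] V_carrier by blast
  note R = subringE[OF subring_lift[OF subring_D]]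
  show "primeideal ?P (K\<lparr>carrier := ?R\<rparr>)"
  proof (rule K.primeideal_subringI[OF subring_lift[OF subring_D]])
    \<comment> \<open>From \<open>(x + y)/y = x/y + 1\<close> in \<open>L\<close> and
      \<open>1/(x + y)\<close> in \<open>L\<close>, their product \<open>1/y\<close> is in
      \<open>L\<close>. So a nonunit \<open>y\<close> cannot give a unit sum when \<open>x/y\<close>
      is in \<open>V\<close>.\<close>
    have aux: "inv y \<in> L"
      if xy: "x \<in> ?R" "y \<in> ?R" "y \<noteq> \<zero>" "x \<otimes> inv y \<in> V" "x \<oplus> y \<noteq> \<zero>" "inv (x \<oplus> y) \<in> L" for x y
    proof -
      have c: "x \<in> carrier K" "y \<in> carrier K" "inv y \<in> carrier K" "inv (x \<oplus> y) \<in> carrier K"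
        using xy RK by (auto simp: K.inv_in_carrier)
      have "(x \<otimes> inv y \<oplus> \<one>) \<otimes> inv (x \<oplus> y) \<in> L"
        using xy assms(2) L(3,6,7) by blast
      also have "x \<otimes> inv y \<oplus> \<one> = (x \<oplus> y) \<otimes> inv y"
        using c xy by (simp add: K.l_distr K.r_inv_nonzero)
      also have "(x \<oplus> y) \<otimes> inv y \<otimes> inv (x \<oplus> y) = inv y \<otimes> ((x \<oplus> y) \<otimes> inv (x \<oplus> y))"
        using c by (simp add: K.m_ac)
      also have "\<dots> = inv y" using K.r_inv_nonzero[of "x \<oplus> y"] c xy(5) by simp
      finally show ?thesis .
    qed
    fix x y assume "x \<in> ?P" "y \<in> ?P"
    then have xy: "x \<in> ?R" "y \<in> ?R" "x = \<zero> \<or> inv x \<notin> L" "y = \<zero> \<or> inv y \<notin> L" by auto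
    have c: "x \<in> carrier K" "y \<in> carrier K" using xy RK by auto
    have "inv (x \<oplus> y) \<notin> L" if s: "x \<oplus> y \<noteq> \<zero>"
    proof
      assume i: "inv (x \<oplus> y) \<in> L"
      have x0: "x \<noteq> \<zero>" using i xy c s by auto
      have y0: "y \<noteq> \<zero>" using i xy c s by auto
      \<comment> \<open>One of \<open>x/y\<close> and \<open>y/x\<close> is in \<open>V\<close>, and
        \<open>aux\<close> is symmetric enough to cover both cases.\<close>
      have "x \<otimes> inv y \<in> V \<or> inv (x \<otimes> inv y) \<in> V"
        using c x0 y0 by (intro valuation) (auto simp: K.inv_in_carrier K.integral_iff K.inv_nonzero)
      moreover have "inv (x \<otimes> inv y) = y \<otimes> inv x"
        using c x0 y0 by (simp add: K.inv_mult_nonzero K.inv_in_carrier K.inv_nonzero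
            K.inv_inv_nonzero K.m_comm)
      ultimately show False
        using aux[of x y] aux[of y x] xy x0 y0 s i c K.a_comm[of x y] by auto
    qed
    then show "x \<oplus> y \<in> ?P" using xy R(7)[of x y] by auto
  next
    fix a x assume "a \<in> ?R" "x \<in> ?P"
    then have ax: "a \<in> ?R" "x \<in> ?R" "x = \<zero> \<or> inv x \<notin> L" by auto
    have c: "a \<in> carrier K" "x \<in> carrier K" using ax RK by auto
    have "inv (a \<otimes> x) \<notin> L" if "a \<otimes> x \<noteq> \<zero>"
    proof
      assume "inv (a \<otimes> x) \<in> L"
      then have "a \<otimes> inv (a \<otimes> x) \<in> L" using L(6) RL[OF ax(1)] by simp
      moreover have "a \<noteq> \<zero>" "x \<noteq> \<zero>" using that c by auto
      ultimately show False using ax c K.inv_eq_multI[of a x] by simp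
    qed
    then show "a \<otimes> x \<in> ?P" using ax R(6)[of a x] by auto
  next
    fix a b assume ab: "a \<in> ?R" "b \<in> ?R" "a \<otimes> b \<in> ?P"
    have c: "a \<in> carrier K" "b \<in> carrier K" using ab RK by auto
    show "a \<in> ?P \<or> b \<in> ?P"
    proof (rule ccontr)
      assume "\<not> (a \<in> ?P \<or> b \<in> ?P)"
      then have "a \<noteq> \<zero>" "b \<noteq> \<zero>" "inv a \<in> L" "inv b \<in> L" using ab by auto
      moreover from this have "inv (a \<otimes> b) \<in> L" using c L(6) by (simp add: K.inv_mult_nonzero)
      ultimately show False using ab c by (simp add: K.integral_iff)
    qed
  qed (use R(2,3) L(3) in auto)
  show "L = subring_localization K ?R ?P"
  proof (rule equalityI; rule subsetI)
    fix x assume x: "x \<in> L"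
    then have xK: "x \<in> carrier K" using L(1) by blast
    show "x \<in> subring_localization K ?R ?P"
    proof (cases "x \<in> V")
      case True
      \<comment> \<open>A lift \<open>\<sigma>\<close> of the denominator \<open>s\<close> is a unit
        of \<open>V\<close>, hence of \<open>L\<close>, and multiplying by it brings
        \<open>x\<close> into the pullback.\<close>
      then obtain a s where as: "a \<in> D" "s \<in> D" "s \<noteq> \<zero>\<^bsub>k\<^esub>" "\<phi> x = a \<otimes>\<^bsub>k\<^esub> inv\<^bsub>k\<^esub> s"
        using quotients[of "\<phi> x"] by auto
      then obtain \<sigma> where \<sigma>: "\<sigma> \<in> V" "\<phi> \<sigma> = s"
        using surj subringE(1)[OF subring_D] by (metis imageE subsetD)
      have nz: "\<sigma> \<noteq> \<zero>" "inv \<sigma> \<in> V" using inv_in_V[of \<sigma>] \<sigma> as by auto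
      have "\<sigma> \<in> ?R - ?P" using \<sigma> as nz assms(2) by (auto simp: lift_def)
      moreover have "\<phi> (x \<otimes> \<sigma>) = a"
        using True \<sigma> as subringE(1)[OF subring_D]
        by (simp add: k.mult_mult_inv_cancel subset_eq)
      then have "x \<otimes> \<sigma> \<in> ?R" using True \<sigma> as by (simp add: lift_def V_closed)
      moreover have "x = x \<otimes> \<sigma> \<otimes> inv \<sigma>"
        using xK V_carrier \<sigma> nz by (simp add: K.mult_mult_inv_cancel)
      ultimately show ?thesis unfolding subring_localization_def by blast
    next
      case False
      note nx = notin_V[OF xK False]
      have "inv x \<in> ?R" using nx by (intro lift_zero subring_D) auto
      moreover have "inv (inv x) = x" using xK nx by (simp add: K.inv_inv_nonzero)
      moreover have "inv x \<noteq> \<zero>" using xK nx K.inv_nonzero by simp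
      \<comment> \<open>Here the kernel element \<open>inv x\<close> serves as denominator; its
        inverse \<open>x\<close> is in \<open>L\<close>, so it avoids \<open>?P\<close>.\<close>
      ultimately have "inv x \<in> ?R - ?P" "x = \<one> \<otimes> inv (inv x)" "\<one> \<in> ?R"
        using x xK R(3) by auto
      then show ?thesis unfolding subring_localization_def by blast
    qed
  next
    fix x assume "x \<in> subring_localization K ?R ?P"
    then show "x \<in> L" using RL L(2,6) unfolding subring_localization_def by auto
  qed
qed

section \<open>Localizations and going-down under lifting\<close>

text \<open>Denominators outside \<open>P\<close> have nonzero image, so they are units of
  \<open>V\<close> and \<open>\<phi>\<close> commutes with forming quotients. Conversely, a
  denominator in \<open>D\<close> is lifted to \<open>V\<close> and used to clear the
  fraction.\<close>

lemma subring_localization_lift: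
  assumes "primeideal P (K\<lparr>carrier := lift D\<rparr>)" "lift {\<zero>\<^bsub>k\<^esub>} \<subseteq> P"
  shows "subring_localization K (lift D) P = lift (subring_localization k D (\<phi> ` P))"
proof (rule equalityI; rule subsetI)
  note P = primeideal_image_lift[OF subring_D assms]
  have mem: "\<phi> s \<in> \<phi> ` P \<longleftrightarrow> s \<in> P" if "s \<in> V" for s
    using P(2) that unfolding lift_def by blast
  have Dk: "d \<in> carrier k" if "d \<in> D" for d using that subringE(1)[OF subring_D] by blast
  have inP: "\<zero>\<^bsub>k\<^esub> \<in> \<phi> ` P" using primeideal_subringE(2)[OF P(1)] .
  {
    fix x assume "x \<in> subring_localization K (lift D) P"
    then obtain a s where as: "a \<in> V" "\<phi> a \<in> D" "s \<in> V" "\<phi> s \<in> D" "s \<notin> P" "x = a \<otimes> inv s"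
      unfolding subring_localization_def lift_def by blast
    have s0: "\<phi> s \<noteq> \<zero>\<^bsub>k\<^esub>" using as mem[of s] inP by auto
    have "\<phi> x = \<phi> a \<otimes>\<^bsub>k\<^esub> inv\<^bsub>k\<^esub> \<phi> s" "x \<in> V"
      using as s0 inv_in_V[of s] \<phi>_inv[of s] V_closed by simp_all
    then show "x \<in> lift (subring_localization k D (\<phi> ` P))"
      using as mem[of s] unfolding subring_localization_def lift_def by blast
  next
    fix x assume "x \<in> lift (subring_localization k D (\<phi> ` P))"
    then obtain a s where as: "x \<in> V" "a \<in> D" "s \<in> D" "s \<notin> \<phi> ` P" "\<phi> x = a \<otimes>\<^bsub>k\<^esub> inv\<^bsub>k\<^esub> s"
      unfolding subring_localization_def lift_def by blast
    obtain \<sigma> where \<sigma>: "\<sigma> \<in> V" "\<phi> \<sigma> = s"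
      using surj Dk[OF as(3)] by (metis imageE)
    have s0: "s \<noteq> \<zero>\<^bsub>k\<^esub>" using as inP by auto
    then have \<sigma>0: "\<sigma> \<noteq> \<zero>" using \<sigma> by auto
    have "\<phi> (x \<otimes> \<sigma>) = a"
      using \<sigma> as s0 Dk by (simp add: k.mult_mult_inv_cancel)
    then have "x \<otimes> \<sigma> \<in> lift D" using \<sigma> as by (simp add: lift_def V_closed)
    moreover have "\<sigma> \<in> lift D - P" using \<sigma> as mem by (auto simp: lift_def)
    moreover have "x = x \<otimes> \<sigma> \<otimes> inv \<sigma>"
      using V_carrier as \<sigma> \<sigma>0 by (simp add: K.mult_mult_inv_cancel)
    ultimately show "x \<in> subring_localization K (lift D) P"
      unfolding subring_localization_def by blast
  }
qed

lemma localization_lift_iff: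
  assumes "subring E k"
  shows "(\<exists>P. primeideal P (K\<lparr>carrier := lift D\<rparr>) \<and> lift E = subring_localization K (lift D) P) \<longleftrightarrow>
    (\<exists>p. primeideal p (k\<lparr>carrier := D\<rparr>) \<and> E = subring_localization k D p)" (is "?L \<longleftrightarrow> ?R")
proof
  note D = subringE[OF subring_D]
  \<comment> \<open>Needed for \<open>lift_eqD\<close>. Denominators outside a prime are nonzero, so
    their inverses are genuine.\<close>
  have loc_sub: "subring_localization k D p \<subseteq> carrier k" if "primeideal p (k\<lparr>carrier := D\<rparr>)" for p
  proof -
    have "a \<otimes>\<^bsub>k\<^esub> inv\<^bsub>k\<^esub> s \<in> carrier k" if "a \<in> D" "s \<in> D" "s \<notin> p" for a s
    proof -
      have "s \<noteq> \<zero>\<^bsub>k\<^esub>" using primeideal_subringE(2)[OF \<open>primeideal p _\<close>] that by blast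
      then show ?thesis using that D(1) k.inv_in_carrier by (intro k.m_closed) auto
    qed
    then show ?thesis unfolding subring_localization_def by blast
  qed
  {
    assume ?L
    then obtain P where P: "primeideal P (K\<lparr>carrier := lift D\<rparr>)"
      "lift E = subring_localization K (lift D) P" by blast
    \<comment> \<open>A kernel element \<open>m\<close> outside \<open>P\<close> would get its
      inverse into \<open>lift E\<close>, hence into \<open>V\<close>, so that \<open>\<one>\<close>
      would map to zero.\<close>
    have "lift {\<zero>\<^bsub>k\<^esub>} \<subseteq> P"
    proof (rule subsetI, rule ccontr)
      fix m assume "m \<in> lift {\<zero>\<^bsub>k\<^esub>}" and mP: "m \<notin> P"
      then have m: "m \<in> V" "\<phi> m = \<zero>\<^bsub>k\<^esub>" by (auto simp: lift_def)
      have m0: "m \<noteq> \<zero>" using mP primeideal_subringE(2)[OF P(1)] by blast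
      have "\<one> \<in> lift D" "m \<in> lift D - P"
        using m mP D by (auto simp: lift_def V_closed)
      then have "\<one> \<otimes> inv m \<in> lift E" unfolding P(2) subring_localization_def by blast
      then have "inv m \<in> V" using lift_subset m m0 V_carrier by (auto simp: K.inv_in_carrier)
      then have "\<phi> (m \<otimes> inv m) = \<zero>\<^bsub>k\<^esub>" using m by simp
      then show False using m m0 V_carrier by (simp add: K.r_inv_nonzero)
    qed
    note P' = primeideal_image_lift[OF subring_D P(1) this] subring_localization_lift[OF P(1) this]
    have "E = subring_localization k D (\<phi> ` P)"
      using P(2) P'(3) subringE(1)[OF assms] loc_sub[OF P'(1)] by (intro lift_eqD) auto
    then show ?R using P'(1) by blast
  next
    assume ?R
    then obtain p where p: "primeideal p (k\<lparr>carrier := D\<rparr>)" "E = subring_localization k D p" by blast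
    have "\<phi> ` lift p = p"
      using primeideal_subringE(1)[OF p(1)] D(1) by (intro image_lift) blast
    moreover have "lift {\<zero>\<^bsub>k\<^esub>} \<subseteq> lift p"
      using primeideal_subringE(2)[OF p(1)] by (intro lift_mono) simp
    ultimately have "lift E = subring_localization K (lift D) (lift p)"
      using subring_localization_lift[OF primeideal_lift[OF subring_D p(1)]] p(2) by simp
    then show ?L using primeideal_lift[OF subring_D p(1)] by blast
  }
qed

text \<open>A prime of \<open>lift D\<close> that does not contain the kernel of \<open>\<phi>\<close> is a prime ideal of \<open>V\<close>,
  hence of every intermediate ring.\<close>

lemma primeideal_lift_if_not_kernel_subset:
  assumes P: "primeideal P (K\<lparr>carrier := lift D\<rparr>)" and "\<not> lift {\<zero>\<^bsub>k\<^esub>} \<subseteq> P"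
    and E: "subring E k" "D \<subseteq> E"
  shows "primeideal P (K\<lparr>carrier := lift E\<rparr>)"
proof -
  note P = primeideal_subringE[OF P]
  obtain m where m: "m \<in> V" "\<phi> m = \<zero>\<^bsub>k\<^esub>" "m \<notin> P"
    using assms(2) by (auto simp: lift_def)
  have PV: "x \<in> V" "x \<in> carrier K" if "x \<in> P" for x
    using that P(1) lift_subset V_carrier by blast+
  \<comment> \<open>An \<open>x\<close> in \<open>P\<close> with nonzero image is a unit of
    \<open>V\<close>. Then \<open>m\<close> is the multiple of \<open>x\<close> by the kernel
    element \<open>m \<otimes> inv x\<close>, and so it lies in \<open>P\<close>.\<close>
  have P0: "\<phi> x = \<zero>\<^bsub>k\<^esub>" if "x \<in> P" for x
  proof (rule ccontr)
    assume "\<phi> x \<noteq> \<zero>\<^bsub>k\<^esub>"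
    note i = inv_in_V[OF PV(1)[OF that] this]
    have "m \<otimes> inv x \<in> lift D" using i m by (intro lift_zero subring_D) (auto simp: V_closed)
    then have "m \<otimes> inv x \<otimes> x \<in> P" using P(5) that by blast
    then show False using m V_carrier PV[OF that] i by (simp add: K.mult_mult_inv_cancel)
  qed
  have mult: "v \<otimes> x \<in> P" if "v \<in> V" "x \<in> P" for v x
  proof -
    note x = PV[OF that(2)] P0[OF that(2)]
    have "v \<otimes> x \<in> lift D" using that x by (intro lift_zero subring_D) (auto simp: V_closed)
    \<comment> \<open>The factor \<open>v\<close> may be outside \<open>lift D\<close>, but
      \<open>v \<otimes> (v \<otimes> x)\<close> is in the kernel. So the square is in
      \<open>P\<close>, and primality removes the square.\<close>
    moreover have "(v \<otimes> x) \<otimes> (v \<otimes> x) \<in> P"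
    proof -
      have "v \<otimes> (v \<otimes> x) \<in> lift D" using that x by (intro lift_zero subring_D) (auto simp: V_closed)
      then have "v \<otimes> (v \<otimes> x) \<otimes> x \<in> P" using P(5) that by blast
      moreover have "v \<otimes> (v \<otimes> x) \<otimes> x = (v \<otimes> x) \<otimes> (v \<otimes> x)"
        using that x V_carrier by (simp add: K.m_ac)
      ultimately show ?thesis by simp
    qed
    ultimately show ?thesis using P(6) by blast
  qed
  show ?thesis
  proof (rule K.primeideal_subringI[OF subring_lift[OF E(1)]])
    show "P \<subseteq> lift E" using P(1) lift_mono[OF E(2)] by blast
    show "a \<otimes> x \<in> P" if "a \<in> lift E" "x \<in> P" for a x
      using mult that lift_subset by blast
    fix a b assume "a \<in> lift E" "b \<in> lift E" and ab: "a \<otimes> b \<in> P"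
    then have V: "a \<in> V" "b \<in> V" using lift_subset by auto
    note c = V[THEN V_carrier]
    show "a \<in> P \<or> b \<in> P"
    \<comment> \<open>If both factors are in the kernel, they belong to \<open>lift D\<close>, where
      \<open>P\<close> is prime. Otherwise one factor is a unit of \<open>V\<close> and
      \<open>mult\<close> cancels it.\<close>
    proof (cases "\<phi> a = \<zero>\<^bsub>k\<^esub>")
      case a: True
      show ?thesis
      proof (cases "\<phi> b = \<zero>\<^bsub>k\<^esub>")
        case True
        then show ?thesis using a V ab P(6) lift_zero[OF subring_D] by blast
      next
        case False
        note i = inv_in_V[OF V(2) False]
        have "inv b \<otimes> (a \<otimes> b) = a \<otimes> b \<otimes> inv b" using c i V_carrier by (simp add: K.m_ac)
        then have "inv b \<otimes> (a \<otimes> b) = a" using c i by (simp add: K.mult_mult_inv_cancel)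
        then show ?thesis using mult[OF i(2) ab] by simp
      qed
    next
      case False
      note i = inv_in_V[OF V(1) False]
      have "inv a \<otimes> (a \<otimes> b) = b \<otimes> a \<otimes> inv a" using c i V_carrier by (simp add: K.m_ac)
      then have "inv a \<otimes> (a \<otimes> b) = b" using c i by (simp add: K.mult_mult_inv_cancel)
      then show ?thesis using mult[OF i(2) ab] by simp
    qed
  qed (use P in auto)
qed

lemma going_down_lift_iff:
  assumes E: "subring E k" "D \<subseteq> E"
  shows "going_down (K\<lparr>carrier := lift D\<rparr>) (K\<lparr>carrier := lift E\<rparr>) \<longleftrightarrow>
    going_down (k\<lparr>carrier := D\<rparr>) (k\<lparr>carrier := E\<rparr>)" (is "?L \<longleftrightarrow> ?R")
proof
  note Ek = subringE(1)[OF E(1)]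
  have sub: "p \<subseteq> carrier k" if "primeideal p (k\<lparr>carrier := D\<rparr>) \<or> primeideal p (k\<lparr>carrier := E\<rparr>)" for p
    using that primeideal_subringE(1) E(2) Ek by blast
  {
    assume gd: ?L
    show ?R
      unfolding going_down_def
    proof (intro allI impI; elim conjE)
      fix p1 p2 q2
      assume p: "primeideal p1 (k\<lparr>carrier := D\<rparr>)" "primeideal p2 (k\<lparr>carrier := D\<rparr>)" "p1 \<subseteq> p2"
        and q: "primeideal q2 (k\<lparr>carrier := E\<rparr>)" "q2 \<inter> carrier (k\<lparr>carrier := D\<rparr>) = p2"
      have "lift q2 \<inter> lift D = lift p2" using q(2) by (simp flip: lift_Int)
      then obtain Q1 where Q1: "primeideal Q1 (K\<lparr>carrier := lift E\<rparr>)" "Q1 \<subseteq> lift q2"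
        "Q1 \<inter> lift D = lift p1"
        using going_downD[OF gd primeideal_lift[OF subring_D p(1)]
            primeideal_lift[OF subring_D p(2)] lift_mono[OF p(3)] primeideal_lift[OF E(1) q(1)]]
        by auto
      \<comment> \<open>The kernel reaches \<open>Q1\<close> through its contraction
        \<open>lift p1\<close>, so \<open>Q1\<close> comes from a prime of \<open>E\<close>.\<close>
      have "lift {\<zero>\<^bsub>k\<^esub>} \<subseteq> lift p1"
        using primeideal_subringE(2)[OF p(1)] by (intro lift_mono) simp
      then have "lift {\<zero>\<^bsub>k\<^esub>} \<subseteq> Q1" using Q1(3) by blast
      note im = primeideal_image_lift[OF E(1) Q1(1) this]
      have "lift (\<phi> ` Q1 \<inter> D) = lift p1" using Q1(3) im(2) by (simp add: lift_Int)
      then have "\<phi> ` Q1 \<inter> D = p1"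
        using sub[of p1] p(1) sub[of "\<phi> ` Q1"] im(1) by (intro lift_eqD) auto
      moreover have "\<phi> ` Q1 \<subseteq> q2" using Q1(2) by (auto simp: lift_def)
      ultimately show "\<exists>q1. primeideal q1 (k\<lparr>carrier := E\<rparr>) \<and> q1 \<subseteq> q2 \<and>
          q1 \<inter> carrier (k\<lparr>carrier := D\<rparr>) = p1"
        using im(1) by auto
    qed
  next
    assume gd: ?R
    show ?L
      unfolding going_down_def
    proof (intro allI impI; elim conjE)
      fix P1 P2 Q2
      assume P: "primeideal P1 (K\<lparr>carrier := lift D\<rparr>)" "primeideal P2 (K\<lparr>carrier := lift D\<rparr>)" "P1 \<subseteq> P2"
        and Q: "primeideal Q2 (K\<lparr>carrier := lift E\<rparr>)" "Q2 \<inter> carrier (K\<lparr>carrier := lift D\<rparr>) = P2"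
      show "\<exists>Q1. primeideal Q1 (K\<lparr>carrier := lift E\<rparr>) \<and> Q1 \<subseteq> Q2 \<and>
          Q1 \<inter> carrier (K\<lparr>carrier := lift D\<rparr>) = P1"
      proof (cases "lift {\<zero>\<^bsub>k\<^esub>} \<subseteq> P1")
        case True
        \<comment> \<open>All three primes contain the kernel, so the whole configuration descends
          to \<open>D\<close> and \<open>E\<close>.\<close>
        then have ker: "lift {\<zero>\<^bsub>k\<^esub>} \<subseteq> P2" "lift {\<zero>\<^bsub>k\<^esub>} \<subseteq> Q2" using P(3) Q(2) by auto
        note P1 = primeideal_image_lift[OF subring_D P(1) True]
          and P2 = primeideal_image_lift[OF subring_D P(2) ker(1)]
          and Q2 = primeideal_image_lift[OF E(1) Q(1) ker(2)]
        have "lift (\<phi> ` Q2 \<inter> D) = lift (\<phi> ` P2)" using Q(2) P2(2) Q2(2) by (simp add: lift_Int)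
        then have "\<phi> ` Q2 \<inter> D = \<phi> ` P2"
          using sub[of "\<phi> ` P2"] P2(1) sub[of "\<phi> ` Q2"] Q2(1) by (intro lift_eqD) auto
        then obtain q1 where q1: "primeideal q1 (k\<lparr>carrier := E\<rparr>)" "q1 \<subseteq> \<phi> ` Q2"
          "q1 \<inter> D = \<phi> ` P1"
          using going_downD[OF gd P1(1) P2(1) image_mono[OF P(3)] Q2(1)] by auto
        have "lift q1 \<subseteq> Q2" using lift_mono[OF q1(2)] Q2(2) by simp
        moreover have "lift q1 \<inter> lift D = P1" using q1(3) P1(2) by (simp flip: lift_Int)
        ultimately show ?thesis using primeideal_lift[OF E(1) q1(1)] by auto
      next
        case False
        then have "primeideal P1 (K\<lparr>carrier := lift E\<rparr>)"
          using primeideal_lift_if_not_kernel_subset P(1) E by blast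
        moreover have "P1 \<subseteq> Q2" "P1 \<inter> lift D = P1"
          using P(3) Q(2) primeideal_subringE(1)[OF P(1)] by auto
        ultimately show ?thesis by auto
      qed
    qed
  }
qed

lemma perinormal_subring_lift_iff:
  "perinormal_subring K (lift D) \<longleftrightarrow> perinormal_subring k D"
proof
  assume K: "perinormal_subring K (lift D)"
  show "perinormal_subring k D"
    unfolding perinormal_subring_def
  proof (intro allI impI; elim conjE)
    fix E assume E: "subring E k" "D \<subseteq> E" "local_ring (k\<lparr>carrier := E\<rparr>)"
      "going_down (k\<lparr>carrier := D\<rparr>) (k\<lparr>carrier := E\<rparr>)"
    then show "\<exists>p. primeideal p (k\<lparr>carrier := D\<rparr>) \<and> E = subring_localization k D p"
      using K[unfolded perinormal_subring_def, rule_format, of "lift E"] subring_lift[OF E(1)]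
        lift_mono[OF E(2)] local_ring_lift_iff[OF E(1)] going_down_lift_iff[OF E(1,2)]
        localization_lift_iff[OF E(1)]
      by simp
  qed
next
  assume k: "perinormal_subring k D"
  show "perinormal_subring K (lift D)"
    unfolding perinormal_subring_def
  proof (intro allI impI; elim conjE)
    fix L assume L: "subring L K" "lift D \<subseteq> L" "local_ring (K\<lparr>carrier := L\<rparr>)"
      "going_down (K\<lparr>carrier := lift D\<rparr>) (K\<lparr>carrier := L\<rparr>)"
    show "\<exists>P. primeideal P (K\<lparr>carrier := lift D\<rparr>) \<and> L = subring_localization K (lift D) P"
    proof (cases "L \<subseteq> V")
      case True
      define E where "E = \<phi> ` L"
      have LE: "L = lift E" using lift_image_eq[OF L(1,2) True] by (simp add: E_def)
      have E: "subring E k" using subring_image[OF L(1) True] by (simp add: E_def)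
      have DE: "D \<subseteq> E"
        using image_mono[OF L(2), of \<phi>] image_lift[OF subringE(1)[OF subring_D]] by (simp add: E_def)
      have "\<exists>p. primeideal p (k\<lparr>carrier := D\<rparr>) \<and> E = subring_localization k D p"
        using k[unfolded perinormal_subring_def, rule_format, of E] L(3,4) E DE
          local_ring_lift_iff[OF E] going_down_lift_iff[OF E DE]
        unfolding LE by simp
      then show ?thesis using localization_lift_iff[OF E] LE by simp
    next
      case False
      then show ?thesis
        using localization_if_V_subset[OF L(1) V_subset_if_not_subset[OF L(1,2)]] by simp
    qed
  qed
qed

end

section \<open>The fraction field of the pullback\<close>

text \<open>Apply the valuation condition to the fraction of \<open>a\<close> by \<open>b\<close>.
  The divisibility form avoids the fraction field of \<open>V\<close>, since later fractions are
  taken over the pullback.\<close>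

lemma valuation_domain_dvd_total:
  assumes "valuation_domain V" "a \<in> carrier V" "b \<in> carrier V"
  shows "\<exists>c \<in> carrier V. a = c \<otimes>\<^bsub>V\<^esub> b \<or> b = c \<otimes>\<^bsub>V\<^esub> a"
proof -
  interpret V: "domain" V using assms(1) by (simp add: valuation_domain_def)
  let ?K = "fraction_field V"
  interpret K: field ?K by (rule V.field_fraction_field)
  note simps = fract_embed_def V.fract_eq_iff V.fract_closed V.fract_mult V.fraction_field_one
    V.fraction_field_zero V.integral_iff
  show ?thesis
  proof (cases "a = \<zero>\<^bsub>V\<^esub> \<or> b = \<zero>\<^bsub>V\<^esub>")
    case True
    then show ?thesis using assms by (intro bexI[of _ "\<zero>\<^bsub>V\<^esub>"]) auto
  next
    case False
    then have nz: "a \<in> carrier V - {\<zero>\<^bsub>V\<^esub>}" "b \<in> carrier V - {\<zero>\<^bsub>V\<^esub>}" using assms by auto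
    have x: "fract V a b \<in> carrier ?K - {\<zero>\<^bsub>?K\<^esub>}" using nz by (simp add: simps)
    have "inv\<^bsub>?K\<^esub> fract V a b = fract V b a"
      using nz by (intro K.comm_inv_char) (simp_all add: simps V.m_ac)
    then have "fract V a b \<in> fract_embed V ` carrier V \<or> fract V b a \<in> fract_embed V ` carrier V"
      using assms(1) x unfolding valuation_domain_def by metis
    then obtain c where "c \<in> carrier V" "fract V a b = fract_embed V c \<or> fract V b a = fract_embed V c"
      by blast
    then show ?thesis 
      using nz V.fract_eq_iff[of a b c "\<one>\<^bsub>V\<^esub>"] V.fract_eq_iff[of b a c "\<one>\<^bsub>V\<^esub>"]
      by (intro bexI[of _ c]) (auto simp: fract_embed_def)
  qed
qed

text \<open>The same data with \<open>V\<close> an abstract domain. The field needed by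
  \<open>residue_square\<close> is to be the fraction field of the pullback, into which
  \<open>V\<close> must first be embedded.\<close>

locale valuation_pullback = V: "domain" V + k: field k
    for V :: "('a, 'm) ring_scheme" (structure) and k :: "('b, 'n) ring_scheme" (structure) +
  fixes \<phi> :: "'a \<Rightarrow> 'b" and D :: "'b set"
  assumes dvd_total: "\<And>a b. a \<in> carrier V \<Longrightarrow> b \<in> carrier V \<Longrightarrow>
      \<exists>c \<in> carrier V. a = c \<otimes> b \<or> b = c \<otimes> a"
    and hom: "\<phi> \<in> ring_hom V k"
    and surj: "\<phi> ` carrier V = carrier k"
    and subring_D: "subring D k"
    and quotients: "\<And>x. x \<in> carrier k \<Longrightarrow> \<exists>a\<in>D. \<exists>s\<in>D. s \<noteq> \<zero>\<^bsub>k\<^esub> \<and> x = a \<otimes>\<^bsub>k\<^esub> inv\<^bsub>k\<^esub> s"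
begin

definition C :: "'a set" where
  "C = {v \<in> carrier V. \<phi> v \<in> D}"

abbreviation "R \<equiv> V\<lparr>carrier := C\<rparr>"
abbreviation "K \<equiv> fraction_field R"

sublocale \<phi>: ring_hom_ring V k \<phi>
  by (rule ring_hom_ringI2[OF V.ring_axioms k.ring_axioms hom])

lemma subring_C: "subring C V"
  by (rule V.subringI) (auto simp: C_def subringE[OF subring_D])

lemma C_iff: "r \<in> C \<longleftrightarrow> r \<in> carrier V \<and> \<phi> r \<in> D"
  by (simp add: C_def)

lemma C_carrier: "r \<in> C \<Longrightarrow> r \<in> carrier V"
  by (simp add: C_def)

sublocale R: "domain" R
  by (rule V.subring_is_domain[OF subring_C])

sublocale K: field K
  by (rule R.field_fraction_field)

text \<open>Take for \<open>r\<close> a lift of a denominator of \<open>\<phi> v\<close>. This is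
  why every element of \<open>V\<close> is a fraction over the pullback.\<close>

lemma clear_denominator:
  assumes "v \<in> carrier V"
  obtains r where "r \<in> C - {\<zero>}" "v \<otimes> r \<in> C"
proof -
  obtain a s where as: "a \<in> D" "s \<in> D" "s \<noteq> \<zero>\<^bsub>k\<^esub>" "\<phi> v = a \<otimes>\<^bsub>k\<^esub> inv\<^bsub>k\<^esub> s"
    using quotients[of "\<phi> v"] assms by auto
  have c: "a \<in> carrier k" "s \<in> carrier k" using as subringE(1)[OF subring_D] by auto
  then obtain r where r: "r \<in> carrier V" "\<phi> r = s" using surj by (metis imageE)
  have "\<phi> (v \<otimes> r) = a" using as r assms c by (simp add: k.mult_mult_inv_cancel)
  moreover have "r \<noteq> \<zero>" using as r by auto
  ultimately show thesis using that[of r] as r assms by (auto simp: C_def)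
qed

text \<open>The junk value \<open>fract_embed R v\<close> at an element \<open>v\<close> of \<open>V\<close> outside \<open>R\<close> is the fraction
  that \<open>v\<close> represents; \<open>fract_embed R\<close> thus embeds all of \<open>V\<close> into the fraction field of \<open>R\<close>.\<close>

lemma fract_embed_eq:
  assumes "v \<in> carrier V" "r \<in> C - {\<zero>}"
  shows "fract_embed R v = fract R (v \<otimes> r) r"
proof -
  have "v \<otimes> d = c \<otimes> \<one> \<longleftrightarrow> v \<otimes> r \<otimes> d = c \<otimes> r" if "c \<in> C" "d \<in> C" for c d
  proof -
    have "v \<otimes> r \<otimes> d = v \<otimes> d \<otimes> r" using assms that C_carrier by (simp add: V.m_ac)
    then show ?thesis using assms that C_carrier by (simp add: V.m_rcancel)
  qed
  then show ?thesis by (auto simp: fract_embed_def fract_def)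
qed

text \<open>Each element is rewritten over a cleared denominator, \<open>r\<close> for
  \<open>v\<close> and \<open>s\<close> for \<open>w\<close>; the formulas for fractions over
  \<open>R\<close> then apply with denominator \<open>r \<otimes> s\<close>.\<close>

lemma fract_embed_ring_hom: "fract_embed R \<in> ring_hom V K"
proof (rule ring_hom_memI)
  have mem: "r \<in> carrier R - {\<zero>\<^bsub>R\<^esub>}" if "r \<in> C - {\<zero>}" for r using that by simp
  note C = subringE[OF subring_C]
  show "fract_embed R \<one> = \<one>\<^bsub>K\<^esub>" by (simp add: R.fraction_field_one fract_embed_def)
  fix v assume v: "v \<in> carrier V"
  then obtain r where r: "r \<in> C - {\<zero>}" "v \<otimes> r \<in> C" by (rule clear_denominator)
  show "fract_embed R v \<in> carrier K"
    unfolding fract_embed_eq[OF v r(1)] using r by (intro R.fract_closed) auto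
  fix w assume w: "w \<in> carrier V"
  then obtain s where s: "s \<in> C - {\<zero>}" "w \<otimes> s \<in> C" by (rule clear_denominator)
  have c: "r \<in> carrier V" "s \<in> carrier V" using r s C_carrier by auto
  have rs: "r \<otimes> s \<in> C - {\<zero>}" using r s C(6) c by (auto simp: V.integral_iff)
  have "fract_embed R (v \<otimes> w) = fract R (v \<otimes> w \<otimes> (r \<otimes> s)) (r \<otimes> s)"
    using v w rs by (intro fract_embed_eq) auto
  also have "v \<otimes> w \<otimes> (r \<otimes> s) = (v \<otimes> r) \<otimes> (w \<otimes> s)"
    using v w c by (simp add: V.m_ac)
  also have "fract R \<dots> (r \<otimes> s) = fract_embed R v \<otimes>\<^bsub>K\<^esub> fract_embed R w"
    unfolding fract_embed_eq[OF v r(1)] fract_embed_eq[OF w s(1)]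
    using R.fract_mult[of "v \<otimes> r" r "w \<otimes> s" s] r s by simp
  finally show "fract_embed R (v \<otimes> w) = fract_embed R v \<otimes>\<^bsub>K\<^esub> fract_embed R w" .
  have "fract_embed R (v \<oplus> w) = fract R ((v \<oplus> w) \<otimes> (r \<otimes> s)) (r \<otimes> s)"
    using v w rs by (intro fract_embed_eq) auto
  also have "(v \<oplus> w) \<otimes> (r \<otimes> s) = (v \<otimes> r) \<otimes> s \<oplus> (w \<otimes> s) \<otimes> r"
    using v w c by (simp add: V.l_distr V.r_distr V.m_ac)
  also have "fract R \<dots> (r \<otimes> s) = fract_embed R v \<oplus>\<^bsub>K\<^esub> fract_embed R w"
    unfolding fract_embed_eq[OF v r(1)] fract_embed_eq[OF w s(1)]
    using R.fract_add[of "v \<otimes> r" r "w \<otimes> s" s] r s by simp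
  finally show "fract_embed R (v \<oplus> w) = fract_embed R v \<oplus>\<^bsub>K\<^esub> fract_embed R w" .
qed

sublocale embed: ring_hom_ring V K "fract_embed R"
  by (rule ring_hom_ringI2[OF V.ring_axioms K.ring_axioms fract_embed_ring_hom])

lemma inj_on_fract_embed_V: "inj_on (fract_embed R) (carrier V)"
proof (rule inj_onI)
  fix v w assume v: "v \<in> carrier V" and w: "w \<in> carrier V" and eq: "fract_embed R v = fract_embed R w"
  obtain r where r: "r \<in> C - {\<zero>}" "v \<otimes> r \<in> C" using v by (rule clear_denominator)
  obtain s where s: "s \<in> C - {\<zero>}" "w \<otimes> s \<in> C" using w by (rule clear_denominator)
  have c: "r \<in> carrier V" "s \<in> carrier V" using r s C_carrier by auto
  have "fract R (v \<otimes> r) r = fract R (w \<otimes> s) s"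
    using eq fract_embed_eq[OF v r(1)] fract_embed_eq[OF w s(1)] by simp
  then have "v \<otimes> r \<otimes> s = w \<otimes> s \<otimes> r"
    using R.fract_eq_iff[of "v \<otimes> r" r "w \<otimes> s" s] r s by simp
  then have "v \<otimes> (r \<otimes> s) = w \<otimes> (r \<otimes> s)" using v w c by (simp add: V.m_ac)
  moreover have "r \<otimes> s \<noteq> \<zero>" using r s c by (simp add: V.integral_iff)
  ultimately show "v = w" using v w c by (simp add: V.m_rcancel)
qed

text \<open>For a fraction of \<open>a\<close> by \<open>b\<close>, \<open>dvd_total\<close> yields
  \<open>c\<close>, whose embedding is the fraction itself or its inverse.\<close>

lemma fract_or_inv_in_V:
  assumes "x \<in> carrier K" "x \<noteq> \<zero>\<^bsub>K\<^esub>"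
  shows "x \<in> fract_embed R ` carrier V \<or> inv\<^bsub>K\<^esub> x \<in> fract_embed R ` carrier V"
proof -
  obtain a b where ab: "a \<in> C" "b \<in> C" "b \<noteq> \<zero>" "x = fract R a b"
    using assms(1) by (elim R.fraction_fieldE) auto
  have a0: "a \<noteq> \<zero>"
    using assms(2) ab R.fract_eq_iff[of a b \<zero> \<one>] R.zero_closed R.one_closed R.one_not_zero C_carrier
    by (auto simp: R.fraction_field_zero)
  have inv: "inv\<^bsub>K\<^esub> x = fract R b a"
  proof (rule K.comm_inv_char)
    show "x \<in> carrier K" by fact
    show "fract R b a \<in> carrier K" using ab a0 by (intro R.fract_closed) auto
    have nz: "a \<in> carrier R - {\<zero>\<^bsub>R\<^esub>}" "b \<in> carrier R - {\<zero>\<^bsub>R\<^esub>}" using ab a0 by auto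
    then show "x \<otimes>\<^bsub>K\<^esub> fract R b a = \<one>\<^bsub>K\<^esub>"
      using R.fract_mult[of a b b a] R.fract_eq_iff[of "a \<otimes>\<^bsub>R\<^esub> b" "b \<otimes>\<^bsub>R\<^esub> a" "\<one>\<^bsub>R\<^esub>" "\<one>\<^bsub>R\<^esub>"]
        R.denom_mult[OF nz(2,1)] R.m_comm[of a b] R.m_closed[of a b] ab(4)
        R.one_closed R.one_not_zero R.l_one[of "a \<otimes>\<^bsub>R\<^esub> b"] R.r_one[of "a \<otimes>\<^bsub>R\<^esub> b"]
      by (metis Diff_iff R.fraction_field_one singletonD)
  qed
  obtain c where c: "c \<in> carrier V" "a = c \<otimes> b \<or> b = c \<otimes> a"
    using dvd_total ab C_carrier by blast
  have "fract_embed R c = x" if "a = c \<otimes> b"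
    using fract_embed_eq[of c b] ab c that by simp
  moreover have "fract_embed R c = inv\<^bsub>K\<^esub> x" if "b = c \<otimes> a"
    unfolding inv using fract_embed_eq[of c a] ab(1) a0 c(1) by (simp flip: that)
  ultimately show ?thesis using c by (metis image_eqI)
qed

text \<open>This is \<open>\<phi>\<close> carried over to the copy of \<open>V\<close> inside
  \<open>K\<close>; only its values on that copy are meaningful.\<close>

definition residue :: "('a \<times> 'a) set \<Rightarrow> 'b" where
  "residue x = \<phi> (inv_into (carrier V) (fract_embed R) x)"

lemma residue_embed: "v \<in> carrier V \<Longrightarrow> residue (fract_embed R v) = \<phi> v"
  by (simp add: residue_def inv_into_f_f[OF inj_on_fract_embed_V])

sublocale residue_square K k "fract_embed R ` carrier V" residue D
proof (intro residue_square.intro residue_square_axioms.intro)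
  show "subring (fract_embed R ` carrier V) K"
    by (rule embed.img_is_subring[OF V.carrier_is_subring])
  show "residue \<in> ring_hom (K\<lparr>carrier := fract_embed R ` carrier V\<rparr>) k"
  proof (rule ring_hom_memI)
    fix x y assume xy: "x \<in> carrier (K\<lparr>carrier := fract_embed R ` carrier V\<rparr>)"
      "y \<in> carrier (K\<lparr>carrier := fract_embed R ` carrier V\<rparr>)"
    then obtain v w where vw: "v \<in> carrier V" "x = fract_embed R v" "w \<in> carrier V" "y = fract_embed R w"
      by auto
    then show "residue x \<in> carrier k" by (simp add: residue_embed)
    show "residue (x \<otimes>\<^bsub>K\<lparr>carrier := fract_embed R ` carrier V\<rparr>\<^esub> y) = residue x \<otimes>\<^bsub>k\<^esub> residue y"
      "residue (x \<oplus>\<^bsub>K\<lparr>carrier := fract_embed R ` carrier V\<rparr>\<^esub> y) = residue x \<oplus>\<^bsub>k\<^esub> residue y"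
      using vw by (simp_all add: residue_embed flip: embed.hom_mult embed.hom_add)
  next
    show "residue \<one>\<^bsub>K\<lparr>carrier := fract_embed R ` carrier V\<rparr>\<^esub> = \<one>\<^bsub>k\<^esub>"
      by (simp add: residue_embed flip: embed.hom_one)
  qed
  show "residue ` fract_embed R ` carrier V = carrier k"
    using surj by (simp add: image_image residue_embed)
qed (use K.field_axioms k.field_axioms fract_or_inv_in_V subring_D quotients in blast)+

lemma perinormal_iff: "perinormal R \<longleftrightarrow> perinormal_subring k D"
proof -
  \<comment> \<open>The embedded pullback is the preimage of \<open>D\<close> in the copy of
    \<open>V\<close>, so both reductions concern one subring of \<open>K\<close>.\<close>
  have "fract_embed R ` carrier R = lift D"
    by (auto simp: lift_def C_iff residue_embed)
  then show ?thesis
    using R.perinormal_iff_perinormal_subring perinormal_subring_lift_iff by simp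
qed

end

theorem theorem2p7:
  fixes D :: "('a, 'm) ring_scheme" and V :: "('b, 'n) ring_scheme"
    and M :: "'b set" and \<theta> :: "'b set \<Rightarrow> ('a \<times> 'a) set"
  assumes "domain D"
    and "valuation_domain V"
    and "maximalideal M V"
    and "\<theta> \<in> ring_iso (V Quot M) (fraction_field D)"
  shows "perinormal (residue_pullback D V (residue_map V M \<theta>)) \<longleftrightarrow> perinormal D"
proof -
  interpret D: "domain" D by fact
  interpret V: "domain" V using assms(2) by (simp add: valuation_domain_def)
  interpret M: maximalideal M V by fact
  interpret k: field "fraction_field D" by (rule D.field_fraction_field)
  interpret j: ring_hom_ring D "fraction_field D" "fract_embed D"
    by (rule ring_hom_ringI2[OF D.ring_axioms k.ring_axioms D.fract_embed_hom])
  let ?\<phi> = "residue_map V M \<theta>"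
  have \<theta>: "\<theta> \<in> ring_hom (V Quot M) (fraction_field D)"
    "\<theta> ` carrier (V Quot M) = carrier (fraction_field D)"
    using assms(4) by (auto simp: ring_iso_def bij_betw_def)
  \<comment> \<open>As a composite of the quotient map and an isomorphism, the residue map is a
    surjective homomorphism.\<close>
  have \<phi>: "?\<phi> = \<theta> \<circ> (+>\<^bsub>V\<^esub>) M" by (auto simp: residue_map_def)
  interpret valuation_pullback V "fraction_field D" ?\<phi> "fract_embed D ` carrier D"
  proof (intro valuation_pullback.intro valuation_pullback_axioms.intro)
    show "?\<phi> \<in> ring_hom V (fraction_field D)"
      unfolding \<phi> by (rule ring_hom_trans[OF M.rcos_ring_hom \<theta>(1)])
    have "(+>\<^bsub>V\<^esub>) M ` carrier V = carrier (V Quot M)"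
      by (auto simp: FactRing_def A_RCOSETS_def')
    then show "?\<phi> ` carrier V = carrier (fraction_field D)"
      using \<theta>(2) unfolding \<phi> by (metis image_comp)
    show "subring (fract_embed D ` carrier D) (fraction_field D)"
      by (rule j.img_is_subring[OF D.carrier_is_subring])
    fix x assume "x \<in> carrier (fraction_field D)"
    then obtain a b where ab: "a \<in> carrier D" "b \<in> carrier D" "b \<noteq> \<zero>\<^bsub>D\<^esub>" "x = fract D a b"
      by (rule D.fraction_fieldE)
    have b0: "fract_embed D b \<noteq> \<zero>\<^bsub>fraction_field D\<^esub>"
      using ab by (simp add: fract_embed_def D.fraction_field_zero D.fract_eq_iff)
    have x: "x = fract_embed D a \<otimes>\<^bsub>fraction_field D\<^esub> inv\<^bsub>fraction_field D\<^esub> fract_embed D b"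
      using ab D.fract_eq_mult_inv[of a b] by simp
    note im = ab(1,2)[THEN imageI, of "fract_embed D"]
    show "\<exists>a\<in>fract_embed D ` carrier D. \<exists>s\<in>fract_embed D ` carrier D.
        s \<noteq> \<zero>\<^bsub>fraction_field D\<^esub> \<and> x = a \<otimes>\<^bsub>fraction_field D\<^esub> inv\<^bsub>fraction_field D\<^esub> s"
      using b0 x im by (intro bexI conjI)
  qed (use valuation_domain_dvd_total[OF assms(2)] V.domain_axioms k.field_axioms in blast)+
  \<comment> \<open>The right side becomes perinormality of the embedded copy of \<open>D\<close> in
    its fraction field, the form in which \<open>perinormal_iff\<close> states it.\<close>
  show ?thesis
    unfolding residue_pullback_def D.perinormal_iff_perinormal_subring
    by (rule perinormal_iff[unfolded C_def])
qed

end
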